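(* For all integers $m\ge 2$ and $n\ge 68$, \[ R_w(\mathcal{Q}_m,\mathcal{Q}_n)\ge m+n+1. \]
   Context: For a positive integer $N$, the Boolean lattice $\mathcal{Q}_N$ is the power set of $[N]=\{1,\dots,N\}$ ordered by inclusion. For posets $P$ and $Q$, an injection $f:P\to Q$ is order-preserving if $f(x)\le f(y)$ whenever $x\le y$; its image is called a weak copy of $P$ in $Q$, and $P$ is then a weak subposet of $Q$. For posets $P_1,P_2$, the weak poset Ramsey number $R_w(P_1,P_2)$ is the smallest integer $N$ such that for every coloring of the elements of $\mathcal{Q}_N$ with the two colors blue and red, there is a weak copy of $P_1$ all of whose elements are blue, or a weak copy of $P_2$ all of whose elements are red. *)

theory Defs
  imports Main
begin

text \<open>
  A poset is a set of elements of a type of class \<^class>\<open>order\<close>, with the induced order. On sets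
  this order is inclusion.
\<close>

definition boolean_lattice :: "nat \<Rightarrow> nat set set" where
  "boolean_lattice N = Pow {1..N}"

definition weak_copy :: "'a::order set \<Rightarrow> 'b::order set \<Rightarrow> 'b set \<Rightarrow> bool" where
  "weak_copy P Q S \<longleftrightarrow> S \<subseteq> Q \<and> (\<exists>f. inj_on f P \<and> mono_on P f \<and> f ` P = S)"

datatype colour = Blue | Red

text \<open>
  A colouring is a total function on \<^typ>\<open>nat set\<close>; only its values on
  \<^term>\<open>boolean_lattice N\<close> matter, since a weak copy is a subset of that set.
\<close>

definition weak_ramsey :: "'a::order set \<Rightarrow> 'b::order set \<Rightarrow> nat \<Rightarrow> bool" where
  "weak_ramsey P1 P2 N \<longleftrightarrow>
     (\<forall>c :: nat set \<Rightarrow> colour.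
        (\<exists>S. weak_copy P1 (boolean_lattice N) S \<and> (\<forall>x\<in>S. c x = Blue)) \<or>
        (\<exists>S. weak_copy P2 (boolean_lattice N) S \<and> (\<forall>x\<in>S. c x = Red)))"

definition weak_ramsey_number :: "'a::order set \<Rightarrow> 'b::order set \<Rightarrow> nat" where
  "weak_ramsey_number P1 P2 = (LEAST N. N > 0 \<and> weak_ramsey P1 P2 N)"

text \<open>
  The minimum in \<^const>\<open>weak_ramsey_number\<close> is attained for finite posets: a long chain in the
  Boolean lattice has a large monochromatic subchain, which contains a weak copy by linear extension.
\<close>

lemma linear_extension_into:
  fixes P :: "'a::order set" and I :: "nat set"
  assumes "finite P" "finite I" "card P \<le> card I"
  shows "\<exists>f. inj_on f P \<and> mono_on P f \<and> f ` P \<subseteq> I"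
  using assms
proof (induction "card P" arbitrary: P I)
  case 0
  then show ?case by (auto simp: monotone_on_def)
next
  case (Suc k)
  then have "P \<noteq> {}" by auto
  then obtain x where x: "x \<in> P" "\<And>y. y \<in> P \<Longrightarrow> x \<le> y \<Longrightarrow> x = y"
    using finite_has_maximal[OF Suc.prems(1)] by metis
  have "I \<noteq> {}" using Suc by auto
  then have M: "Max I \<in> I" "\<And>i. i \<in> I \<Longrightarrow> i \<le> Max I" using Suc.prems by auto
  have "k = card (P - {x})" "card (P - {x}) \<le> card (I - {Max I})"
    using Suc x M by auto
  then obtain f where f: "inj_on f (P - {x})" "mono_on (P - {x}) f"
      "f ` (P - {x}) \<subseteq> I - {Max I}"
    using Suc.hyps(1)[of "P - {x}" "I - {Max I}"] Suc.prems by auto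
  let ?g = "f(x := Max I)"
  have "inj_on ?g P"
    using f(1,3) unfolding inj_on_def by (auto simp: image_subset_iff)
  moreover have "mono_on P ?g"
  proof (rule monotone_onI)
    fix a b assume ab: "a \<in> P" "b \<in> P" "a \<le> b"
    show "?g a \<le> ?g b"
    proof (cases "b = x")
      case True
      then show ?thesis using f(3) M ab by auto
    next
      case False
      then have "a \<noteq> x" using x ab by auto
      then show ?thesis using False ab monotone_onD[OF f(2)] by simp
    qed
  qed
  moreover have "?g ` P \<subseteq> I" using f(3) M by auto
  ultimately show ?case by blast
qed

lemma weak_copy_in_chain:
  fixes P :: "'a::order set"
  assumes "finite P" "I \<subseteq> {..N}" "card P \<le> card I"
  shows "\<exists>S. weak_copy P (boolean_lattice N) S \<and> S \<subseteq> (\<lambda>i. {1..i}) ` I"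
proof -
  have "finite I" using assms(2) finite_subset by blast
  then obtain f where f: "inj_on f P" "mono_on P f" "f ` P \<subseteq> I"
    using linear_extension_into assms by metis
  let ?g = "\<lambda>p. {1..f p}"
  have "inj_on ?g P" using f(1) by (auto simp: inj_on_def)
  moreover have "mono_on P ?g" using f(2) by (fastforce simp: monotone_on_def)
  moreover have "?g ` P \<subseteq> boolean_lattice N"
    using f(3) assms(2) by (fastforce simp: boolean_lattice_def)
  ultimately have "weak_copy P (boolean_lattice N) (?g ` P)"
    unfolding weak_copy_def by blast
  then show ?thesis using f(3) by blast
qed

lemma weak_ramsey_exists:
  fixes P1 :: "'a::order set" and P2 :: "'b::order set"
  assumes "finite P1" "finite P2"
  shows "\<exists>N>0. weak_ramsey P1 P2 N"
proof (intro exI conjI)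
  let ?N = "card P1 + card P2 + 1"
  show "weak_ramsey P1 P2 ?N"
    unfolding weak_ramsey_def
  proof
    fix c :: "nat set \<Rightarrow> colour"
    define B where "B = {i\<in>{..?N}. c {1..i} = Blue}"
    define R where "R = {i\<in>{..?N}. c {1..i} = Red}"
    have "c X = Blue \<or> c X = Red" for X by (cases "c X") auto
    then have "B \<union> R = {..?N}" unfolding B_def R_def by blast
    then have "card B + card R \<ge> ?N + 1" using card_Un_le[of B R] by simp
    then have "card P1 \<le> card B \<or> card P2 \<le> card R" by linarith
    then show "(\<exists>S. weak_copy P1 (boolean_lattice ?N) S \<and> (\<forall>x\<in>S. c x = Blue)) \<or>
        (\<exists>S. weak_copy P2 (boolean_lattice ?N) S \<and> (\<forall>x\<in>S. c x = Red))"
    proof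
      assume "card P1 \<le> card B"
      moreover have "B \<subseteq> {..?N}" unfolding B_def by blast
      ultimately obtain S where S: "weak_copy P1 (boolean_lattice ?N) S" "S \<subseteq> (\<lambda>i. {1..i}) ` B"
        using weak_copy_in_chain[OF assms(1)] by blast
      then have "\<forall>x\<in>S. c x = Blue" unfolding B_def by blast
      then show ?thesis using S(1) by blast
    next
      assume "card P2 \<le> card R"
      moreover have "R \<subseteq> {..?N}" unfolding R_def by blast
      ultimately obtain S where S: "weak_copy P2 (boolean_lattice ?N) S" "S \<subseteq> (\<lambda>i. {1..i}) ` R"
        using weak_copy_in_chain[OF assms(2)] by blast
      then have "\<forall>x\<in>S. c x = Red" unfolding R_def by blast
      then show ?thesis using S(1) by blast
    qed
  qed
qed simp

end

theory Submission
  imports Defs Complex_Main "HOL-Library.FuncSet"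
begin

text \<open>
  By symmetry let \<open>m \<le> n\<close>; put \<open>N = m + n\<close> and \<open>k = m + (n - 1) div 2\<close>. Take a family \<open>G\<close> of
  \<open>(k + 1)\<close>-subsets of \<open>[N]\<close>, no two sharing a \<open>k\<close>-subset, and a marked point \<open>p g \<in> g\<close> for each
  \<open>g \<in> G\<close>. Colour blue the levels \<open>0, ..., m - 2\<close>, the family \<open>G\<close>, and every \<open>k\<close>-set that is not of
  the form \<open>g - {x}\<close> with \<open>g \<in> G\<close> and \<open>x \<noteq> p g\<close>; all other sets are red. Every \<open>g \<in> G\<close> contains only
  one blue \<open>k\<close>-set, so the two top levels of a blue copy of \<open>Q\<^sub>m\<close> do not fit.

  A red copy \<open>f\<close> of \<open>Q\<^sub>n\<close> has only one level to skip, so \<open>|f X|\<close> is \<open>|X| + m - 1\<close> or \<open>|X| + m\<close>, and the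
  packing property forces the first value on singletons and the second on their complements. Hence
  every \<open>f Y\<close> is \<open>A \<union> \<phi>(Y)\<close> or \<open>[N] - \<psi>(Y\<^sup>c)\<close>, where the injections \<open>\<phi>\<close> and \<open>\<psi>\<close> agree except possibly
  at one point, at which \<open>\<phi>\<close> takes the unique value \<open>w \<notin> A\<close> missed by \<open>\<psi>\<close>. If some \<open>g \<in> G\<close> contains
  \<open>A\<close>, has \<open>p g = w\<close> and avoids a prescribed further point, then for \<open>Y = \<psi>\<^sup>-\<^sup>1(g)\<close> the two options
  are the blue sets \<open>g - {w}\<close> and \<open>g\<close>.

  A packing \<open>G\<close> that serves all triples of \<open>A\<close>, \<open>w\<close> and an avoided point is found at random: label
  every \<open>(k + 1)\<close>-set \<open>g\<close> independently by a number up to \<open>8n\<^sup>3\<close>, call \<open>g\<close> active if its label is one of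
  its elements (which is then \<open>p g\<close>), and keep the active sets without active neighbours. A triple has
  at least \<open>192n\<^sup>8\<close> candidates, hence \<open>48n\<^sup>4\<close> with disjoint neighbourhoods, and these succeed
  independently with probability at least \<open>1/(16n\<^sup>3)\<close>, which beats the union bound over
  \<open>2\<^sup>m\<^sup>+\<^sup>n(m + n)\<^sup>2\<close> triples since \<open>768n\<^sup>9 \<le> 2\<^sup>n\<close> for \<open>n \<ge> 68\<close>.
\<close>

section \<open>Random independent sets\<close>

lemma card_Int_independent:
  fixes V :: "'b set" and K :: "'a set"
  defines "\<Omega> \<equiv> K \<rightarrow>\<^sub>E V"
  assumes sub: "E1 \<subseteq> \<Omega>" "E2 \<subseteq> \<Omega>"
    and dep1: "\<And>c d. c \<in> E1 \<Longrightarrow> d \<in> \<Omega> \<Longrightarrow> (\<And>x. x \<in> K1 \<Longrightarrow> c x = d x) \<Longrightarrow> d \<in> E1"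
    and dep2: "\<And>c d. c \<in> E2 \<Longrightarrow> d \<in> \<Omega> \<Longrightarrow> (\<And>x. x \<in> K2 \<Longrightarrow> c x = d x) \<Longrightarrow> d \<in> E2"
    and disj: "K1 \<inter> K2 = {}"
  shows "card (E1 \<inter> E2) * card \<Omega> = card E1 * card E2"
proof -
  \<comment> \<open>Exchanging the \<open>K1\<close>-coordinates of two labellings maps \<open>E1 \<times> E2\<close> onto \<open>(E1 \<inter> E2) \<times> \<Omega>\<close>.\<close>
  define mix :: "('a \<Rightarrow> 'b) \<Rightarrow> ('a \<Rightarrow> 'b) \<Rightarrow> 'a \<Rightarrow> 'b"
    where "mix c d = (\<lambda>x. if x \<in> K1 then c x else d x)" for c d
  define h where "h = (\<lambda>(c, d). (mix c d, mix d c))"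
  have mix: "mix c d \<in> \<Omega>" if "c \<in> \<Omega>" "d \<in> \<Omega>" for c d
    using that unfolding \<Omega>_def mix_def by (auto simp: PiE_iff extensional_def)
  have inv: "h (h z) = z" for z
    by (cases z) (auto simp: h_def mix_def)
  have mix1: "mix c d \<in> E1" if "c \<in> E1" "d \<in> \<Omega>" for c d
    using dep1[OF that(1) mix] that sub(1) by (auto simp: mix_def)
  have mix2: "mix c d \<in> E2" if "c \<in> \<Omega>" "d \<in> E2" for c d
    
  proof (rule dep2[OF that(2) mix])
    show "d x = mix c d x" if "x \<in> K2" for x using that disj by (auto simp: mix_def)
  qed (use that sub(2) in auto)
  have "bij_betw h (E1 \<times> E2) ((E1 \<inter> E2) \<times> \<Omega>)"
  proof (rule bij_betw_byWitness[where f' = h])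
    show "h ` (E1 \<times> E2) \<subseteq> (E1 \<inter> E2) \<times> \<Omega>"
    proof (rule image_subsetI)
      fix z assume "z \<in> E1 \<times> E2"
      then obtain c d where z: "z = (c, d)" "c \<in> E1" "d \<in> E2" by blast
      then have "c \<in> \<Omega>" "d \<in> \<Omega>" using sub by blast+
      then show "h z \<in> (E1 \<inter> E2) \<times> \<Omega>"
        using z mix1[of c d] mix2[of c d] mix[of d c] by (simp add: h_def)
    qed
    show "h ` ((E1 \<inter> E2) \<times> \<Omega>) \<subseteq> E1 \<times> E2"
    proof (rule image_subsetI)
      fix z assume "z \<in> (E1 \<inter> E2) \<times> \<Omega>"
      then obtain c d where "z = (c, d)" "c \<in> E1" "c \<in> E2" "d \<in> \<Omega>" by blast
      then show "h z \<in> E1 \<times> E2"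
        using mix1[of c d] mix2[of d c] by (simp add: h_def)
    qed
  qed (auto simp: inv)
  then show ?thesis
    by (metis bij_betw_same_card card_cartesian_product)
qed

lemma card_PiE_coordinate:
  assumes "finite K" "v \<in> K" "W \<subseteq> V"
  shows "card {c \<in> K \<rightarrow>\<^sub>E V. c v \<in> W} * card V = card W * card (K \<rightarrow>\<^sub>E V)"
proof -
  have "{c \<in> K \<rightarrow>\<^sub>E V. c v \<in> W} = (\<Pi>\<^sub>E u\<in>K. if u = v then W else V)"
    using assms(2,3) by (auto simp: PiE_iff extensional_def split: if_splits) blast+
  then have "card {c \<in> K \<rightarrow>\<^sub>E V. c v \<in> W} = (\<Prod>u\<in>K. if u = v then card W else card V)"
    using card_PiE[OF assms(1), of "\<lambda>u. if u = v then W else V"] by (simp add: if_distrib cong: if_cong)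
  also have "\<dots> = card W * (\<Prod>u\<in>K - {v}. card V)"
    using assms(1,2) by (subst prod.remove[of _ v]) (auto intro!: prod.cong)
  also have "\<dots> * card V = card W * (\<Prod>u\<in>K. card V)"
    unfolding prod.remove[OF assms(1,2)] by simp
  finally show ?thesis
    using card_PiE[OF assms(1), of "\<lambda>_. V"] by simp
qed

text \<open>Greedy choice. If the closed neighbourhoods of \<open>u\<close> and \<open>v\<close>
  meet, then \<open>u\<close> is within two \<open>R\<close>-steps of \<open>v\<close>, and at most
  \<open>\<delta>\<^sup>2\<close> elements of \<open>K\<close> are. So each chosen element spoils at
  most that many candidates, itself included.\<close>

lemma scattered_subfamily:
  fixes R :: "'a \<Rightarrow> 'a \<Rightarrow> bool"
  assumes "finite K" and refl: "\<And>v. R v v" and sym: "\<And>u v. R u v \<Longrightarrow> R v u"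
    and deg: "\<And>v. v \<in> K \<Longrightarrow> card {u \<in> K. R v u} \<le> \<delta>" and "\<delta> > 0"
    and "C \<subseteq> K" "\<delta>\<^sup>2 * L \<le> card C"
  shows "\<exists>I\<subseteq>C. card I = L \<and>
    (\<forall>u\<in>I. \<forall>v\<in>I. u \<noteq> v \<longrightarrow> {x \<in> K. R u x} \<inter> {x \<in> K. R v x} = {})"
  using assms(6,7)
proof (induction L arbitrary: C)
  case 0
  then show ?case by (intro exI[of _ "{}"]) auto
next
  case (Suc L)
  have finC: "finite C" using Suc.prems(1) \<open>finite K\<close> finite_subset by blast
  have "card C > 0" using Suc.prems(2) \<open>\<delta> > 0\<close>
    by (metis gr0I less_nat_zero_code mult_is_0 le_zero_eq nat.distinct(1) power_eq_0_iff)
  then obtain v where v: "v \<in> C" by (metis card_gt_0_iff ex_in_conv)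
  define Bad where "Bad = (\<Union>x\<in>{x \<in> K. R v x}. {u \<in> K. R x u})"
  have "card Bad \<le> (\<Sum>x\<in>{x \<in> K. R v x}. card {u \<in> K. R x u})"
    unfolding Bad_def using \<open>finite K\<close> by (intro card_UN_le) auto
  also have "\<dots> \<le> card {x \<in> K. R v x} * \<delta>"
    using sum_bounded_above[of "{x \<in> K. R v x}" "\<lambda>x. card {u \<in> K. R x u}" \<delta>] deg by simp
  also have "\<dots> \<le> \<delta>\<^sup>2"
    using deg v Suc.prems(1) by (auto simp: power2_eq_square)
  finally have Bad: "card Bad \<le> \<delta>\<^sup>2" .
  have finBad: "finite Bad" unfolding Bad_def using \<open>finite K\<close> by auto
  have "\<delta>\<^sup>2 * L \<le> card C - card Bad" using Suc.prems(2) Bad by simp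
  also have "\<dots> \<le> card (C - Bad)" using finBad by (rule diff_card_le_card_Diff)
  finally obtain I where I: "I \<subseteq> C - Bad" "card I = L"
    "\<And>u w. u \<in> I \<Longrightarrow> w \<in> I \<Longrightarrow> u \<noteq> w \<Longrightarrow> {x \<in> K. R u x} \<inter> {x \<in> K. R w x} = {}"
    using Suc.IH[of "C - Bad"] Suc.prems(1) by blast
  have vK: "v \<in> K" using v Suc.prems(1) by blast
  then have "v \<in> Bad" unfolding Bad_def using refl by blast
  then have "v \<notin> I" using I(1) by blast
  have far: "{x \<in> K. R v x} \<inter> {x \<in> K. R u x} = {}" if "u \<in> I" for u
    using that I(1) Suc.prems(1) sym unfolding Bad_def by blast
  show ?case
  proof (intro exI[of _ "insert v I"] conjI)
    show "card (insert v I) = Suc L"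
      using \<open>v \<notin> I\<close> I(1,2) finC by (simp add: finite_subset[OF I(1)])
    show "\<forall>u\<in>insert v I. \<forall>w\<in>insert v I. u \<noteq> w \<longrightarrow> {x \<in> K. R u x} \<inter> {x \<in> K. R w x} = {}"
    proof (intro ballI impI)
      fix u w assume "u \<in> insert v I" "w \<in> insert v I" "u \<noteq> w"
      then consider "u = v" "w \<in> I" | "u \<in> I" "w = v" | "u \<in> I" "w \<in> I" by blast
      then show "{x \<in> K. R u x} \<inter> {x \<in> K. R w x} = {}"
        by cases (use far[of u] far[of w] I(3)[OF _ _ \<open>u \<noteq> w\<close>] in blast)+
    qed
  qed (use v I in auto)
qed

text \<open>The random selection in abstract form: \<open>\<delta>\<close> bounds the closed
  neighbourhoods, \<open>q\<close> the label sets, and \<open>L\<close> is the number of independent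
  trials extracted for each test \<open>(w, C)\<close>. A trial succeeds with probability at least
  \<open>1 / (2 * card V)\<close>.\<close>

lemma exists_labelled_independent_set:
  fixes R :: "'a \<Rightarrow> 'a \<Rightarrow> bool" and lab :: "'a \<Rightarrow> 'b set" and tests :: "('b \<times> 'a set) set"
  assumes finK: "finite K" and finV: "finite V" and "V \<noteq> {}"
    and refl: "\<And>v. R v v" and sym: "\<And>u v. R u v \<Longrightarrow> R v u"
    and deg: "\<And>v. v \<in> K \<Longrightarrow> card {u \<in> K. R v u} \<le> \<delta>" and "\<delta> > 0"
    and lab: "\<And>v. v \<in> K \<Longrightarrow> lab v \<subseteq> V" "\<And>v. v \<in> K \<Longrightarrow> card (lab v) \<le> q"
    and V: "2 * \<delta> * q \<le> card V"
    and "finite tests"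
    and tests: "\<And>w C. (w, C) \<in> tests \<Longrightarrow> w \<in> V \<and> C \<subseteq> K \<and> \<delta>\<^sup>2 * L \<le> card C \<and> (\<forall>v\<in>C. w \<in> lab v)"
    and union: "real (card tests) * (1 - 1 / (2 * real (card V))) ^ L < 1"
  obtains G p where "G \<subseteq> K" "\<And>u v. u \<in> G \<Longrightarrow> v \<in> G \<Longrightarrow> R u v \<Longrightarrow> u = v"
    "\<And>w C. (w, C) \<in> tests \<Longrightarrow> \<exists>v\<in>C. v \<in> G \<and> p v = w"
proof -
  define \<Omega> where "\<Omega> = K \<rightarrow>\<^sub>E V"
  define N where "N v = {u \<in> K. R v u}" for v
  \<comment> \<open>Success of \<open>v\<close> for the label \<open>w\<close>: no other member of
    the closed neighbourhood \<open>N v\<close> is active. Only the coordinates in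
    \<open>N v\<close> decide this event.\<close>
  define S where "S v w = {c \<in> \<Omega>. c v = w \<and> (\<forall>u\<in>N v - {v}. c u \<notin> lab u)}" for v w
  define Q where "Q = real (card V)"
  define s where "s = 1 / (2 * Q)"
  define P where "P E = real (card E) / real (card \<Omega>)" for E :: "('a \<Rightarrow> 'b) set"
  have fin\<Omega>: "finite \<Omega>" unfolding \<Omega>_def using finK finV by (intro finite_PiE) auto
  have Q: "Q \<ge> 1" unfolding Q_def using finV \<open>V \<noteq> {}\<close> by (simp add: Suc_leI card_gt_0_iff)
  have \<Omega>_pos: "card \<Omega> > 0" unfolding \<Omega>_def using finV \<open>V \<noteq> {}\<close> finK
    by (simp add: card_PiE card_gt_0_iff)
  have P_indep: "P (E1 \<inter> E2) = P E1 * P E2"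
    if "E1 \<subseteq> \<Omega>" "E2 \<subseteq> \<Omega>"
      "\<And>c d. c \<in> E1 \<Longrightarrow> d \<in> \<Omega> \<Longrightarrow> (\<And>x. x \<in> K1 \<Longrightarrow> c x = d x) \<Longrightarrow> d \<in> E1"
      "\<And>c d. c \<in> E2 \<Longrightarrow> d \<in> \<Omega> \<Longrightarrow> (\<And>x. x \<in> K2 \<Longrightarrow> c x = d x) \<Longrightarrow> d \<in> E2"
      "K1 \<inter> K2 = {}" for E1 E2 K1 K2
  proof -
    have "card (E1 \<inter> E2) * card \<Omega> = card E1 * card E2"
      using card_Int_independent[of E1 K V E2 K1 K2] that unfolding \<Omega>_def by blast
    then have "real (card (E1 \<inter> E2)) * real (card \<Omega>) = real (card E1) * real (card E2)"
      by (metis of_nat_mult)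
    then show ?thesis unfolding P_def using \<Omega>_pos by (simp add: field_simps)
  qed
  have P_coord: "P {c \<in> \<Omega>. c v \<in> W} = real (card W) / Q" if "v \<in> K" "W \<subseteq> V" for v W
  proof -
    have "real (card {c \<in> \<Omega>. c v \<in> W}) * Q = real (card W) * real (card \<Omega>)"
      using arg_cong[OF card_PiE_coordinate[OF finK that], of real] unfolding \<Omega>_def Q_def by simp
    then show ?thesis unfolding P_def using \<Omega>_pos Q by (simp add: field_simps)
  qed
  have P_mono: "P E \<le> P E'" if "E \<subseteq> E'" "E' \<subseteq> \<Omega>" for E E'
    unfolding P_def using card_mono[OF finite_subset[OF that(2) fin\<Omega>] that(1)]
    by (simp add: divide_right_mono)
  have P_Un: "P (\<Union>i\<in>J. E i) \<le> (\<Sum>i\<in>J. P (E i))" if "finite J" for J :: "'c set" and E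
  proof -
    have "real (card (\<Union>i\<in>J. E i)) \<le> (\<Sum>i\<in>J. real (card (E i)))"
      using card_UN_le[OF that, of E] by (simp flip: of_nat_sum)
    then show ?thesis unfolding P_def by (simp add: divide_right_mono flip: sum_divide_distrib)
  qed
  have S_sub: "S v w \<subseteq> \<Omega>" for v w unfolding S_def by blast
  have S_dep: "d \<in> S v w" if "c \<in> S v w" "d \<in> \<Omega>" "\<And>x. x \<in> N v \<Longrightarrow> c x = d x" "v \<in> K" for c d v w
  proof -
    have "v \<in> N v" using that(4) refl by (simp add: N_def)
    then show ?thesis using that unfolding S_def by auto
  qed
  have S_ge: "P (S v w) \<ge> s" if v: "v \<in> K" and w: "w \<in> lab v" for v w
  proof -
    \<comment> \<open>\<open>X\<close> has probability \<open>1 / Q\<close> and misses success only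
      if one of at most \<open>\<delta>\<close> neighbours \<open>u\<close> is active as well, each
      at a cost of at most \<open>q / Q\<^sup>2\<close>. By
      \<open>2 * \<delta> * q \<le> card V\<close> half of \<open>1 / Q\<close> survives.\<close>
    define X where "X = {c \<in> \<Omega>. c v \<in> {w}}"
    define Y where "Y u = {c \<in> \<Omega>. c u \<in> lab u}" for u
    have PX: "P X = 1 / Q" using P_coord[of v "{w}"] v w lab(1) unfolding X_def by auto
    have PXY: "P (X \<inter> Y u) \<le> 1 / Q * (real q / Q)" if u: "u \<in> N v - {v}" for u
    proof -
      have uK: "u \<in> K" using u by (simp add: N_def)
      have "P (X \<inter> Y u) = P X * P (Y u)"
        using u by (intro P_indep[of _ _ "{v}" "{u}"]) (auto simp: X_def Y_def)
      also have "\<dots> = 1 / Q * (real (card (lab u)) / Q)"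
        unfolding PX Y_def using P_coord[OF uK lab(1)[OF uK]] by simp
      also have "\<dots> \<le> 1 / Q * (real q / Q)"
        using lab(2)[OF uK] Q by (intro mult_left_mono divide_right_mono) auto
      finally show ?thesis .
    qed
    have finN: "finite (N v)" using finK by (simp add: N_def)
    have "X \<subseteq> S v w \<union> (\<Union>u\<in>N v - {v}. X \<inter> Y u)"
      unfolding X_def Y_def S_def by auto
    then have "P X \<le> P (S v w \<union> (\<Union>u\<in>N v - {v}. X \<inter> Y u))"
      by (rule P_mono) (auto simp: X_def S_def)
    also have "\<dots> \<le> P (S v w) + P (\<Union>u\<in>N v - {v}. X \<inter> Y u)"
      using P_Un[of "{True, False}" "\<lambda>b. if b then S v w else (\<Union>u\<in>N v - {v}. X \<inter> Y u)"]
      by (simp add: Un_commute)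
    also have "P (\<Union>u\<in>N v - {v}. X \<inter> Y u) \<le> (\<Sum>u\<in>N v - {v}. P (X \<inter> Y u))"
      using finN by (intro P_Un) simp
    also have "\<dots> \<le> real (card (N v - {v})) * (1 / Q * (real q / Q))"
      using PXY by (intro sum_bounded_above)
    also have "\<dots> \<le> real \<delta> * (1 / Q * (real q / Q))"
    proof (intro mult_right_mono)
      have "card (N v - {v}) \<le> card (N v)" using finN by (intro card_mono) auto
      then show "real (card (N v - {v})) \<le> real \<delta>" using deg[OF v] by (simp add: N_def)
    qed (use Q in auto)
    also have "\<dots> \<le> s"
    proof -
      have "2 * (real \<delta> * real q) \<le> Q"
        using V unfolding Q_def by (metis mult.assoc of_nat_le_iff of_nat_mult of_nat_numeral)
      then show ?thesis unfolding s_def using Q by (simp add: field_simps)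
    qed
    finally have "1 / Q \<le> P (S v w) + s" using PX by simp
    then show ?thesis unfolding s_def by simp
  qed
  have s: "0 \<le> 1 - s" unfolding s_def using Q by simp
  \<comment> \<open>Disjoint neighbourhoods make the failures independent; each new member of
    \<open>I\<close> contributes one more factor \<open>1 - s\<close>.\<close>
  have fail: "P {c \<in> \<Omega>. \<forall>v\<in>I. c \<notin> S v w} \<le> (1 - s) ^ card I"
    if "finite I" "I \<subseteq> K" "\<And>v. v \<in> I \<Longrightarrow> w \<in> lab v"
      "\<And>u v. u \<in> I \<Longrightarrow> v \<in> I \<Longrightarrow> u \<noteq> v \<Longrightarrow> N u \<inter> N v = {}" for I w
    using that
  proof (induction I)
    case empty
    then show ?case by (simp add: P_def)
  next
    case (insert v I)
    define F where "F = {c \<in> \<Omega>. \<forall>v\<in>I. c \<notin> S v w}"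
    have vK: "v \<in> K" using insert.prems by blast
    have "P {c \<in> \<Omega>. \<forall>v\<in>insert v I. c \<notin> S v w} = P (F \<inter> (\<Omega> - S v w))"
      unfolding F_def by (rule arg_cong[where f = P]) auto
    also have "\<dots> = P F * P (\<Omega> - S v w)"
    proof (rule P_indep[of _ _ "\<Union>u\<in>I. N u" "N v"])
      show "(\<Union>u\<in>I. N u) \<inter> N v = {}" using insert by blast
      show "d \<in> F" if "c \<in> F" "d \<in> \<Omega>" "\<And>x. x \<in> (\<Union>u\<in>I. N u) \<Longrightarrow> c x = d x" for c d
      proof -
        have "d \<notin> S u w" if u: "u \<in> I" for u
        proof
          assume "d \<in> S u w"
          moreover have "c \<in> \<Omega>" "c \<notin> S u w" using \<open>c \<in> F\<close> u unfolding F_def by auto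
          ultimately show False
            using S_dep[of d u w c] \<open>\<And>x. x \<in> (\<Union>u\<in>I. N u) \<Longrightarrow> c x = d x\<close> u insert.prems(1) by force
        qed
        then show ?thesis using that(2) unfolding F_def by blast
      qed
      show "d \<in> \<Omega> - S v w" if "c \<in> \<Omega> - S v w" "d \<in> \<Omega>" "\<And>x. x \<in> N v \<Longrightarrow> c x = d x" for c d
        using S_dep[of d v w c] that vK by force
    qed (auto simp: F_def)
    also have "\<dots> \<le> (1 - s) ^ card I * (1 - s)"
    proof (intro mult_mono)
      show "P F \<le> (1 - s) ^ card I" unfolding F_def using insert by (intro insert.IH) auto
      have "P (\<Omega> - S v w) = 1 - P (S v w)"
        using card_Diff_subset[OF finite_subset[OF S_sub fin\<Omega>] S_sub, of v w]
          card_mono[OF fin\<Omega> S_sub, of v w] \<Omega>_pos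
        unfolding P_def by (simp add: of_nat_diff field_simps)
      then show "P (\<Omega> - S v w) \<le> 1 - s" using S_ge[OF vK insert.prems(2)[of v]] by simp
    qed (use s in \<open>auto simp: P_def\<close>)
    also have "\<dots> = (1 - s) ^ card (insert v I)" using insert.hyps by simp
    finally show ?case .
  qed
  define Bad where "Bad = (\<lambda>(w, C). {c \<in> \<Omega>. \<forall>v\<in>C. c \<notin> S v w})"
  have "P (Bad z) \<le> (1 - s) ^ L" if "z \<in> tests" for z
  proof -
    obtain w C where z: "z = (w, C)" by force
    have C: "C \<subseteq> K" "\<delta>\<^sup>2 * L \<le> card C" "\<And>v. v \<in> C \<Longrightarrow> w \<in> lab v"
      using tests that z by auto
    obtain I where I: "I \<subseteq> C" "card I = L"
      "\<And>u v. u \<in> I \<Longrightarrow> v \<in> I \<Longrightarrow> u \<noteq> v \<Longrightarrow> N u \<inter> N v = {}"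
      using scattered_subfamily[where R = R, OF finK refl sym deg \<open>\<delta> > 0\<close> C(1,2)] unfolding N_def by blast
    have "P (Bad z) \<le> P {c \<in> \<Omega>. \<forall>v\<in>I. c \<notin> S v w}"
      using I(1) by (intro P_mono) (auto simp: Bad_def z)
    also have "\<dots> \<le> (1 - s) ^ card I"
    proof (rule fail)
      show "finite I" using I(1) C(1) finK by (meson finite_subset)
    qed (use I C in auto)
    finally show ?thesis using I(2) by simp
  qed
  then have "P (\<Union>z\<in>tests. Bad z) \<le> real (card tests) * (1 - s) ^ L"
    using order_trans[OF P_Un sum_bounded_above] \<open>finite tests\<close> by blast
  also have "\<dots> < 1" using union unfolding s_def Q_def .
  finally have "P (\<Union>z\<in>tests. Bad z) < P \<Omega>" using \<Omega>_pos by (simp add: P_def)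
  then have "\<not> \<Omega> \<subseteq> (\<Union>z\<in>tests. Bad z)"
    using P_mono[of \<Omega> "\<Union>z\<in>tests. Bad z"] by (auto simp: Bad_def)
  then obtain c where c: "c \<in> \<Omega>" "\<And>z. z \<in> tests \<Longrightarrow> c \<notin> Bad z" by blast
  \<comment> \<open>The labelling \<open>c\<close> passes every test and also serves as
    \<open>p\<close>. Of two distinct related members of \<open>G\<close>, each would be an active
    neighbour of the other.\<close>
  define G where "G = {v \<in> K. c v \<in> lab v \<and> (\<forall>u\<in>N v - {v}. c u \<notin> lab u)}"
  show ?thesis
  proof (rule that[of G c])
    show "G \<subseteq> K" unfolding G_def by blast
    show "u = v" if "u \<in> G" "v \<in> G" "R u v" for u v
      using that unfolding G_def N_def by blast
    show "\<exists>v\<in>C. v \<in> G \<and> c v = w" if wC: "(w, C) \<in> tests" for w C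
    proof -
      have "\<exists>v\<in>C. c \<in> S v w" using c(1) c(2)[OF wC] by (simp add: Bad_def)
      then obtain v where "v \<in> C" "c \<in> S v w" by blast
      then have "v \<in> G" "c v = w" using tests[OF wC] unfolding G_def S_def by auto
      then show ?thesis using \<open>v \<in> C\<close> by blast
    qed
  qed
qed

section \<open>Numerical estimates\<close>

text \<open>At 68 the bound is a computation; from there one step multiplies \<open>n ^ 9\<close> by
  at most \<open>(69 / 68) ^ 9 \<le> 2\<close>, while the right side doubles.\<close>

lemma pow9_le_two_power:
  fixes n :: nat
  assumes "n \<ge> 68"
  shows "768 * n ^ 9 \<le> 2 ^ n"
  using assms
proof (induction n rule: dec_induct)
  case base
  show ?case by simp
next
  case (step n)
  have "real (Suc n) ^ 9 \<le> 2 * real n ^ 9"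
  proof -
    have "1 + 1 / real n \<le> 69 / 68" using step by (simp add: field_simps)
    then have "(1 + 1 / real n) ^ 9 \<le> (69 / 68) ^ 9" by (intro power_mono) auto
    also have "\<dots> \<le> 2" by (simp add: field_simps)
    finally have "(1 + 1 / real n) ^ 9 * real n ^ 9 \<le> 2 * real n ^ 9"
      by (intro mult_right_mono) auto
    moreover have "(1 + 1 / real n) ^ 9 * real n ^ 9 = real (Suc n) ^ 9"
      using step by (simp add: field_simps flip: power_mult_distrib)
    ultimately show ?thesis by simp
  qed
  then have "real (Suc n ^ 9) \<le> real (2 * n ^ 9)"
    by (simp only: of_nat_power of_nat_mult of_nat_numeral)
  then have "Suc n ^ 9 \<le> 2 * n ^ 9" by (simp only: of_nat_le_iff)
  then show ?case using step by simp
qed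

text \<open>For \<open>n = 2 * a\<close> the coefficient is half of \<open>2 * a choose a\<close>.
  For \<open>n = 2 * a + 1\<close> it lies one off the centre of row \<open>2 * a\<close>, and
  Pascal's rule still leaves at least half. The lower bound for central coefficients does the
  rest.\<close>

lemma two_power_le_choose_half:
  assumes "n \<ge> 4"
  shows "2 ^ n \<le> 4 * n * ((n - 1) choose Suc ((n - 1) div 2))"
proof -
  have central: "4 ^ a \<le> 2 * a * ((2 * a) choose a)" if "a > 0" for a :: nat
  proof -
    have "real (4 ^ a) \<le> real (2 * a * ((2 * a) choose a))"
      using central_binomial_lower_bound[OF that] that by (simp add: field_simps)
    then show ?thesis by linarith
  qed
  have up: "(2 * a choose a) = 2 * (2 * a - 1 choose a)" if a_pos: "a > 0" for a :: nat
  proof -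
    obtain b where a: "a = Suc b" using gr0_implies_Suc[OF a_pos] by blast
    have c: "2 * a = Suc (2 * b + 1)" "2 * a - 1 = 2 * b + 1" by (simp_all add: a)
    have "(2 * b + 1 choose b) = (2 * b + 1 choose a)"
      using binomial_symmetric[of b "2 * b + 1"] by (simp add: a)
    moreover have "(Suc (2 * b + 1) choose a) = (2 * b + 1 choose b) + (2 * b + 1 choose a)"
      unfolding a by (rule binomial_Suc_Suc)
    ultimately show ?thesis unfolding c(2) unfolding c(1) by linarith
  qed
  show ?thesis
  proof (cases "even n")
    case True
    then obtain a where n: "n = 2 * a" by (elim evenE)
    then have "a > 0" using assms by simp
    have "Suc ((n - 1) div 2) = a" using n \<open>a > 0\<close> by presburger
    then show ?thesis using central[OF \<open>a > 0\<close>] up[OF \<open>a > 0\<close>] n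
      by (simp add: power_mult)
  next
    case False
    then obtain a where n: "n = 2 * a + 1" by (elim oddE)
    then have "a > 1" using assms by simp
    then obtain b where b: "2 * a = Suc b" by (cases "2 * a") auto
    have "(b choose Suc a) + (b choose a) = (2 * a choose Suc a)"
      by (simp add: b)
    moreover have "2 * (b choose a) = (2 * a choose a)" using up[of a] b \<open>a > 1\<close> by simp
    moreover have "Suc ((n - 1) div 2) = Suc a" using n by simp
    ultimately have "(2 * a choose a) \<le> 2 * ((n - 1) choose Suc ((n - 1) div 2))"
      using n by simp
    then have "2 * a * (2 * a choose a) \<le> 2 * a * (2 * ((n - 1) choose Suc ((n - 1) div 2)))"
      by (rule mult_le_mono2)
    also have "\<dots> = 4 * a * ((n - 1) choose Suc ((n - 1) div 2))" by simp
    finally have "4 ^ a \<le> 4 * a * ((n - 1) choose Suc ((n - 1) div 2))"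
      using central[of a] \<open>a > 1\<close> by linarith
    then have "2 ^ n \<le> 2 * (4 * a * ((n - 1) choose Suc ((n - 1) div 2)))"
      using n by (simp add: power_mult)
    also have "\<dots> \<le> 4 * n * ((n - 1) choose Suc ((n - 1) div 2))"
      using n by (simp add: algebra_simps)
    finally show ?thesis .
  qed
qed

text \<open>The left side is \<open>(2 * n\<^sup>2)\<^sup>2 * (48 * n ^ 4)\<close>: the candidates
  needed to extract \<open>48 * n ^ 4\<close> scattered ones under the degree bound
  \<open>2 * n\<^sup>2\<close>.\<close>

lemma pow8_le_choose_half:
  fixes n :: nat
  assumes "n \<ge> 68"
  shows "192 * n ^ 8 \<le> ((n - 1) choose Suc ((n - 1) div 2))"
proof -
  have "n ^ 9 = n * n ^ 8" using power_Suc[of n 8] by simp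
  then have "(4 * n) * (192 * n ^ 8) = 768 * n ^ 9" by simp
  also have "\<dots> \<le> (4 * n) * ((n - 1) choose Suc ((n - 1) div 2))"
    using pow9_le_two_power[OF assms] two_power_le_choose_half[of n] assms by simp
  finally show ?thesis using assms by simp
qed

lemma one_minus_inverse_power_le_half:
  fixes q :: nat
  assumes "q \<ge> 1"
  shows "(1 - 1 / real q) ^ q \<le> 1 / 2"
proof -
  have "1 - 1 / real q \<le> exp (- (1 / real q))" using exp_ge_add_one_self[of "- (1 / real q)"] by simp
  then have "(1 - 1 / real q) ^ q \<le> exp (- (1 / real q)) ^ q"
    using assms by (intro power_mono) auto
  also have "\<dots> = exp (- 1)" using assms by (simp flip: exp_of_nat_mult)
  also have "\<dots> \<le> 1 / 2" using exp_ge_add_one_self[of "1::real"] by (simp add: exp_minus field_simps)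
  finally show ?thesis .
qed

text \<open>The exponent consists of \<open>3 * n\<close> blocks of length
  \<open>16 * n ^ 3\<close>, each worth a factor of at most 1/2. Against this stand fewer than
  \<open>2 ^ (3 * n)\<close> tests, because \<open>m \<le> n\<close> and
  \<open>(2 * n)\<^sup>2 < 2 ^ n\<close>.\<close>

lemma union_bound_lt_one:
  fixes m n :: nat
  assumes "m \<le> n" "n \<ge> 68" "T \<le> 2 ^ (m + n) * (m + n)\<^sup>2"
  shows "real T * (1 - 1 / (2 * real (8 * n ^ 3))) ^ (48 * n ^ 4) < 1"
proof -
  define q where "q = 16 * n ^ 3"
  have "q \<ge> 1" using assms(2) by (simp add: q_def Suc_le_eq)
  have "n ^ 4 = n ^ 3 * n" using power_Suc2[of n 3] by simp
  then have "48 * n ^ 4 = q * (3 * n)" by (simp add: q_def)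
  then have "(1 - 1 / real q) ^ (48 * n ^ 4) = ((1 - 1 / real q) ^ q) ^ (3 * n)"
    by (simp only: power_mult)
  also have "\<dots> \<le> (1 / 2) ^ (3 * n)"
    using one_minus_inverse_power_le_half[of q] \<open>q \<ge> 1\<close>
    by (intro power_mono zero_le_power) auto
  finally have *: "(1 - 1 / real q) ^ (48 * n ^ 4) \<le> (1 / 2) ^ (3 * n)" .
  have "T < 2 ^ (3 * n)"
  proof -
    have "T \<le> 2 ^ (m + n) * (m + n)\<^sup>2" by fact
    also have "\<dots> \<le> 2 ^ (2 * n) * (2 * n)\<^sup>2"
      using assms(1) by (intro mult_mono power_increasing power_mono) auto
    also have "\<dots> < 2 ^ (2 * n) * 2 ^ n"
    proof -
      have "(2 * n)\<^sup>2 = 4 * n ^ 2 * 1" by (simp add: power_mult_distrib)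
      also have "\<dots> < 768 * n ^ 2 * n ^ 7" using assms(2) by (intro mult_less_le_imp_less) auto
      also have "\<dots> = 768 * n ^ 9" by (simp flip: power_add)
      also have "\<dots> \<le> 2 ^ n" by (rule pow9_le_two_power) fact
      finally show ?thesis by simp
    qed
    finally show ?thesis by (simp flip: power_add)
  qed
  then have "real T < 2 ^ (3 * n)" by (metis of_nat_less_iff of_nat_numeral of_nat_power)
  have "real T * (1 - 1 / real q) ^ (48 * n ^ 4) \<le> real T * (1 / 2) ^ (3 * n)"
    using * by (intro mult_left_mono) auto
  also have "\<dots> < 2 ^ (3 * n) * (1 / 2) ^ (3 * n)"
    using \<open>real T < 2 ^ (3 * n)\<close> by (intro mult_strict_right_mono) auto
  also have "\<dots> = 1" by (simp flip: power_mult_distrib)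
  finally show ?thesis by (simp add: q_def)
qed

section \<open>Red copies\<close>

lemma finite_boolean_lattice: "finite (boolean_lattice N)"
  by (simp add: boolean_lattice_def)

text \<open>Adding one point to the argument enlarges the image strictly, by monotonicity and
  injectivity.\<close>

lemma inj_mono_card_growth:
  fixes f :: "nat set \<Rightarrow> nat set"
  assumes inj: "inj_on f (boolean_lattice n)" and mono: "mono_on (boolean_lattice n) f"
    and into: "f ` boolean_lattice n \<subseteq> boolean_lattice N"
    and X: "X \<subseteq> Y" and Y: "Y \<in> boolean_lattice n"
  shows "card (f X) + card (Y - X) \<le> card (f Y)"
proof -
  have "finite Y" using Y by (auto simp: boolean_lattice_def intro: finite_subset)
  then have "finite (Y - X)" by simp
  then show ?thesis using X Y
  proof (induction "Y - X" arbitrary: Y)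
    case empty
    then have "X = Y" by blast
    then show ?case by simp
  next
    case (insert a F)
    define Y' where "Y' = Y - {a}"
    have a: "a \<in> Y" "a \<notin> X" using insert.hyps by auto
    have Y': "X \<subseteq> Y'" "Y' \<in> boolean_lattice n" "F = Y' - X"
      using insert by (auto simp: Y'_def boolean_lattice_def)
    have "card (f X) + card F \<le> card (f Y')" using insert.hyps(3)[OF Y'(3,1,2)] Y'(3) by simp
    moreover have "f Y' \<subset> f Y"
    proof
      show "f Y' \<subseteq> f Y" using monotone_onD[OF mono Y'(2) insert.prems(2)] by (auto simp: Y'_def)
      show "f Y' \<noteq> f Y" using inj_onD[OF inj _ Y'(2) insert.prems(2)] a by (auto simp: Y'_def)
    qed
    moreover have "finite (f Y)"
      using into insert.prems(2) by (auto simp: boolean_lattice_def intro: finite_subset)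
    ultimately have "card (f X) + card F < card (f Y)"
      using psubset_card_mono[of "f Y" "f Y'"] by linarith
    then show ?case using card_insert_disjoint[OF insert.hyps(1,2)] insert.hyps(4) by simp
  qed
qed

lemma insert_of_card_Suc:
  assumes "finite B" "A \<subseteq> B" "card B = Suc (card A)"
  obtains b where "b \<notin> A" "B = insert b A"
proof -
  have "card (B - A) = 1" using assms by (simp add: card_Diff_subset finite_subset)
  then obtain b where "B - A = {b}" by (auto simp: card_1_singleton_iff)
  then show ?thesis using that[of b] assms(2) by blast
qed

text \<open>Redness enters only through \<open>low\<close>, \<open>level\<close> and
  \<open>blue\<close>, with \<open>k = m + t\<close>. The bound \<open>t \<ge> 2\<close> lets
  \<open>lower_eq\<close> reach singletons, \<open>t + 3 \<le> n\<close> lets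
  \<open>upper_eq\<close> reach their complements, and \<open>n < 2 * t + 3\<close> decides the
  count in \<open>upper_eq\<close>.\<close>

lemma no_red_copy:
  fixes f :: "nat set \<Rightarrow> nat set"
  assumes inj: "inj_on f (boolean_lattice n)" and mono: "mono_on (boolean_lattice n) f"
    and into: "f ` boolean_lattice n \<subseteq> boolean_lattice (m + n)"
    and "m \<ge> 1" "t \<ge> 2" "t + 3 \<le> n" "n < 2 * t + 3"
    and G: "\<And>g. g \<in> G \<Longrightarrow> g \<subseteq> {1..m + n}" "\<And>g. g \<in> G \<Longrightarrow> card g = m + t + 1"
    and packing: "\<And>g g'. g \<in> G \<Longrightarrow> g' \<in> G \<Longrightarrow> m + t \<le> card (g \<inter> g') \<Longrightarrow> g = g'"
    and cover: "\<And>A w w'. A \<subseteq> {1..m + n} \<Longrightarrow> Suc (card A) = m \<Longrightarrow> w \<in> {1..m + n} - A \<Longrightarrow>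
      w' \<in> {1..m + n} - A \<Longrightarrow> w \<noteq> w' \<Longrightarrow> \<exists>g\<in>G. p g = w \<and> w \<in> g \<and> A \<subseteq> g \<and> w' \<notin> g"
    and low: "\<And>X. X \<in> boolean_lattice n \<Longrightarrow> m \<le> Suc (card (f X))"
    and level: "\<And>X. X \<in> boolean_lattice n \<Longrightarrow> card (f X) = m + t \<Longrightarrow> \<exists>g\<in>G. f X \<subseteq> g"
    and blue: "\<And>X. X \<in> boolean_lattice n \<Longrightarrow> f X \<notin> G"
      "\<And>X g. X \<in> boolean_lattice n \<Longrightarrow> g \<in> G \<Longrightarrow> f X \<noteq> g - {p g}"
  shows False
proof -
  let ?N = "m + n"
  note growth = inj_mono_card_growth[OF inj mono into]
  have Pow: "X \<in> boolean_lattice n \<longleftrightarrow> X \<subseteq> {1..n}" for X by (simp add: boolean_lattice_def)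
  have fN: "f X \<subseteq> {1..?N}" if "X \<subseteq> {1..n}" for X
    using into that by (auto simp: boolean_lattice_def)
  have fin: "finite X" if "X \<subseteq> {1..n}" for X :: "nat set" using that finite_subset by blast
  have finf: "finite (f X)" if "X \<subseteq> {1..n}" for X using fN[OF that] finite_subset by blast
  have fmono: "f X \<subseteq> f Y" if "X \<subseteq> Y" "Y \<subseteq> {1..n}" for X Y
    using monotone_onD[OF mono, of X Y] that by (auto simp: Pow)
  have feq: "X = Y" if "f X = f Y" "X \<subseteq> {1..n}" "Y \<subseteq> {1..n}" for X Y
    using inj_onD[OF inj that(1)] that by (auto simp: Pow)
  \<comment> \<open>A maximal chain through \<open>X\<close> has \<open>n + 1\<close> members, and
    its image has only the \<open>n + 2\<close> levels from \<open>m - 1\<close> to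
    \<open>m + n\<close> at its disposal, so it skips at most one.\<close>
  have dich: "Suc (card (f X)) = card X + m \<or> card (f X) = card X + m" if "X \<subseteq> {1..n}" for X
  proof -
    have "card (f {}) + card X \<le> card (f X)" using growth[of "{}" X] that by (simp add: Pow)
    moreover have "m \<le> Suc (card (f {}))" using low[of "{}"] by (simp add: Pow)
    moreover have "card (f X) + card ({1..n} - X) \<le> card (f {1..n})"
      using growth[of X "{1..n}"] that by (simp add: Pow)
    moreover have "card (f {1..n}) \<le> ?N" using card_mono[OF _ fN[of "{1..n}"]] by simp
    moreover have "card ({1..n} - X) = n - card X" using that by (simp add: card_Diff_subset fin)
    moreover have "card X \<le> n" using card_mono[OF _ that] by simp
    ultimately show ?thesis by linarith
  qed
  \<comment> \<open>Otherwise the copy climbs from some \<open>X'\<close> of size \<open>t - 1\<close> through all \<open>k\<close>-sets above \<open>f X'\<close>, and the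
    member of \<open>G\<close> above one of them is an image.\<close>
  have lower_eq: "Suc (card (f X)) = card X + m" if X: "X \<subseteq> {1..n}" "card X < t" for X
  proof (rule ccontr)
    assume "Suc (card (f X)) \<noteq> card X + m"
    then have fX: "card (f X) = card X + m" using dich X by blast
    obtain Z where Z: "Z \<subseteq> {1..n} - X" "card Z = t - 1 - card X"
    proof (rule obtain_subset_with_card_n[of "t - 1 - card X" "{1..n} - X"])
      show "t - 1 - card X \<le> card ({1..n} - X)"
        using assms(6) X by (simp add: card_Diff_subset fin)
    qed blast
    define X' where "X' = X \<union> Z"
    have X': "X \<subseteq> X'" "X' \<subseteq> {1..n}" "X' - X = Z" using Z X by (auto simp: X'_def)
    have cX': "Suc (card X') = t"
    proof -
      have "card (X \<union> Z) = card X + card Z"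
        using Z fin[OF X(1)] fin[of Z] by (intro card_Un_disjoint) auto
      then show ?thesis using Z(2) X(2) by (simp add: X'_def)
    qed
    have up: "card (f Y) = card Y + m" if "X \<subseteq> Y" "Y \<subseteq> {1..n}" for Y
    proof -
      have "card (f X) + card (Y - X) \<le> card (f Y)" using growth that by (simp add: Pow)
      then show ?thesis using dich[OF that(2)] fX card_Diff_subset[OF fin[OF X(1)] that(1)]
        card_mono[OF fin[OF that(2)] that(1)] by linarith
    qed
    have "\<exists>a. a \<notin> f X' \<and> f (insert i X') = insert a (f X')" if i: "i \<in> {1..n} - X'" for i
    proof -
      have "insert i X' \<subseteq> {1..n}" using i X' by auto
      moreover have "card (f (insert i X')) = Suc (card (f X'))"
        using up[of X'] up[of "insert i X'"] i X' fin[OF X'(2)] by auto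
      ultimately show ?thesis
        using insert_of_card_Suc[OF finf fmono[OF subset_insertI]] by metis
    qed
    then obtain a where a: "\<And>i. i \<in> {1..n} - X' \<Longrightarrow> a i \<notin> f X'"
      "\<And>i. i \<in> {1..n} - X' \<Longrightarrow> f (insert i X') = insert (a i) (f X')" by metis
    have inja: "inj_on a ({1..n} - X')"
    proof (rule inj_onI)
      fix i j assume ij: "i \<in> {1..n} - X'" "j \<in> {1..n} - X'" "a i = a j"
      then have "f (insert i X') = f (insert j X')" using a by simp
      then have "insert i X' = insert j X'" using feq ij X' by (metis DiffD1 insert_subset)
      then show "i = j" using ij by blast
    qed
    \<comment> \<open>Both sides have \<open>n - t + 1\<close> points, so every point outside
      \<open>f X'\<close> is the one added by some \<open>i\<close>.\<close>
    have surj: "a ` ({1..n} - X') = {1..?N} - f X'"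
    proof (rule card_subset_eq)
      show "a ` ({1..n} - X') \<subseteq> {1..?N} - f X'"
      proof clarify
        fix i assume i: "i \<in> {1..n}" "i \<notin> X'"
        then have "a i \<in> f (insert i X')" using a(2)[of i] by blast
        then show "a i \<in> {1..?N} - f X'" using fN[of "insert i X'"] i X' a(1)[of i] by blast
      qed
      have "card (a ` ({1..n} - X')) = n - card X'"
        using card_image[OF inja] X' by (simp add: card_Diff_subset fin)
      also have "\<dots> = card ({1..?N} - f X')"
        using up[of X'] X' fN[of X'] by (simp add: card_Diff_subset finf)
      finally show "card (a ` ({1..n} - X')) = card ({1..?N} - f X')" .
    qed simp
    have "card X' < n" using cX' assms(6) by simp
    then obtain i where i: "i \<in> {1..n} - X'"
      using card_mono[OF fin[OF X'(2)], of "{1..n}"] by fastforce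
    have iX: "insert i X' \<subseteq> {1..n}" using i X' by auto
    have "X \<subseteq> insert i X'" using X'(1) by blast
    then have ci: "card (f (insert i X')) = m + t" using up[OF _ iX] i cX' fin[OF X'(2)] by auto
    then obtain g where g: "g \<in> G" "f (insert i X') \<subseteq> g" using level[of "insert i X'"] iX by (auto simp: Pow)
    have fing: "finite g" using G(1)[OF g(1)] finite_subset by blast
    obtain b where b: "b \<notin> f (insert i X')" "g = insert b (f (insert i X'))"
      using insert_of_card_Suc[OF fing g(2)] G(2)[OF g(1)] ci by auto
    have "b \<in> {1..?N} - f X'" using b G(1)[OF g(1)] fmono[OF subset_insertI iX] by auto
    then obtain j where j: "j \<in> {1..n} - X'" "b = a j" using surj by blast
    have "j \<noteq> i" using b(1) j(2) a(2)[OF i] by auto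
    have ijX: "insert j (insert i X') \<subseteq> {1..n}" using iX j by auto
    \<comment> \<open>\<open>g\<close> is \<open>f (insert i X')\<close> together with
      \<open>b = a j\<close>, which lies in \<open>f (insert j X')\<close>. The image of the union
      has size \<open>m + t + 1\<close> like \<open>g\<close>, hence equals it.\<close>
    have "g \<subseteq> f (insert j (insert i X'))"
    proof -
      have "f (insert i X') \<subseteq> f (insert j (insert i X'))" by (rule fmono[OF _ ijX]) auto
      moreover have "f (insert j X') \<subseteq> f (insert j (insert i X'))" by (rule fmono[OF _ ijX]) auto
      ultimately show ?thesis using b(2) j a(2)[OF j(1)] by auto
    qed
    moreover have "X \<subseteq> insert j (insert i X')" using X'(1) by blast
    then have "card (f (insert j (insert i X'))) = card g"
      using up[OF _ ijX] i j \<open>j \<noteq> i\<close> cX' fin[OF X'(2)] G(2)[OF g(1)] by auto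
    ultimately have "f (insert j (insert i X')) = g"
      using card_subset_eq[OF finf[OF ijX]] by metis
    then show False using blue(1)[of "insert j (insert i X')"] ijX g(1) by (simp add: Pow)
  qed
  \<comment> \<open>Otherwise \<open>t + 2\<close> of the \<open>k\<close>-subsets of some image \<open>f Y'\<close> lie below members of \<open>G\<close>, which by the
    packing property use distinct points outside \<open>f Y'\<close>; there are only \<open>n - t - 1\<close> of those.\<close>
  have upper_eq: "card (f Y) = card Y + m" if Y: "Y \<subseteq> {1..n}" "card Y > t + 1" for Y
  proof (rule ccontr)
    assume "card (f Y) \<noteq> card Y + m"
    then have fY: "Suc (card (f Y)) = card Y + m" using dich Y by blast
    have "t + 2 \<le> card Y" using Y by simp
    then obtain Y' where Y': "Y' \<subseteq> Y" "card Y' = t + 2"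
      using obtain_subset_with_card_n by metis
    have Y'n: "Y' \<subseteq> {1..n}" using Y Y' by blast
    have down: "Suc (card (f X)) = card X + m" if "X \<subseteq> Y" for X
    proof -
      have Xn: "X \<subseteq> {1..n}" using that Y by blast
      have "card (f X) + card (Y - X) \<le> card (f Y)" using growth that Y by (simp add: Pow)
      then show ?thesis using dich[OF Xn] fY card_Diff_subset[OF fin[OF Xn] that]
        card_mono[OF fin[OF Y(1)] that] by linarith
    qed
    have cY': "card (f Y') = m + t + 1" using down[OF Y'(1)] Y'(2) by simp
    have ci: "card (f (Y' - {i})) = m + t" if "i \<in> Y'" for i
    proof -
      have "Suc (card (f (Y' - {i}))) = card (Y' - {i}) + m" using down[of "Y' - {i}"] Y'(1) by blast
      then show ?thesis using that Y'(2) fin[OF Y'n] by simp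
    qed
    have sub: "f (Y' - {i}) \<subseteq> f Y'" for i by (rule fmono[OF _ Y'n]) auto
    have full: "g = f Y'" if "g \<in> G" "f Y' \<subseteq> g" for g
      using card_subset_eq[of g "f Y'"] that G cY' finite_subset[OF G(1)[OF that(1)]] by simp
    have "\<exists>g b. g \<in> G \<and> b \<in> {1..?N} - f Y' \<and> g = insert b (f (Y' - {i}))" if i: "i \<in> Y'" for i
    proof -
      have "Y' - {i} \<in> boolean_lattice n" using Y'n by (auto simp: Pow)
      then obtain g where g: "g \<in> G" "f (Y' - {i}) \<subseteq> g" using level ci[OF i] by blast
      have fing: "finite g" using G(1)[OF g(1)] finite_subset by blast
      obtain b where b: "b \<notin> f (Y' - {i})" "g = insert b (f (Y' - {i}))"
        using insert_of_card_Suc[OF fing g(2)] G(2)[OF g(1)] ci[OF i] by auto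
      have "b \<notin> f Y'"
      proof
        assume "b \<in> f Y'"
        then have "g \<subseteq> f Y'" using b sub by auto
        then have "g = f Y'" using card_subset_eq[OF finf[OF Y'n]] G(2)[OF g(1)] cY' by simp
        then show False using blue(1)[of Y'] Y'n g(1) by (simp add: Pow)
      qed
      then show ?thesis using b g(1) G(1)[OF g(1)] by blast
    qed
    then obtain g b where gb: "\<And>i. i \<in> Y' \<Longrightarrow> g i \<in> G" "\<And>i. i \<in> Y' \<Longrightarrow> b i \<in> {1..?N} - f Y'"
      "\<And>i. i \<in> Y' \<Longrightarrow> g i = insert (b i) (f (Y' - {i}))" by metis
    \<comment> \<open>If \<open>b i = b j\<close>, then \<open>g i\<close> and \<open>g j\<close>
      lie in \<open>f Y'\<close> plus one point, so they share at least
      \<open>2 * (m + t + 1) - (m + t + 2)\<close> points and coincide by \<open>packing\<close>.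
      That set contains two distinct \<open>(m + t)\<close>-subsets of \<open>f Y'\<close>, hence is
      \<open>f Y'\<close>, which is not in \<open>G\<close>.\<close>
    have "inj_on b Y'"
    proof (rule inj_onI, rule ccontr)
      fix i j assume ij: "i \<in> Y'" "j \<in> Y'" "b i = b j" "i \<noteq> j"
      have finG: "finite (g i)" "finite (g j)" using gb(1) ij G(1) finite_subset by blast+
      have "g i \<union> g j \<subseteq> insert (b i) (f Y')" using gb(3) ij sub by auto
      then have "card (g i \<union> g j) \<le> card (insert (b i) (f Y'))"
        using finf[OF Y'n] by (intro card_mono) auto
      also have "\<dots> = m + t + 2" using finf[OF Y'n] gb(2)[OF ij(1)] cY' by simp
      finally have "card (g i \<union> g j) \<le> m + t + 2" .
      then have "m + t \<le> card (g i \<inter> g j)"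
        using card_Un_Int[OF finG] G(2)[OF gb(1)[OF ij(1)]] G(2)[OF gb(1)[OF ij(2)]] by linarith
      then have "g i = g j" using packing gb(1) ij by blast
      then have sub2: "f (Y' - {i}) \<union> f (Y' - {j}) \<subseteq> g i" using gb(3) ij by auto
      have "Y' - {i} \<noteq> Y' - {j}" using ij by blast
      then have ne: "f (Y' - {i}) \<noteq> f (Y' - {j})" using feq[of "Y' - {i}" "Y' - {j}"] Y'n by blast
      have fini: "finite (f (Y' - {i}))" using finite_subset[OF sub finf[OF Y'n]] .
      then have "\<not> f (Y' - {j}) \<subseteq> f (Y' - {i})"
        using card_subset_eq[OF fini, of "f (Y' - {j})"] ne ci[OF ij(1)] ci[OF ij(2)] by auto
      then have "f (Y' - {i}) \<subset> f (Y' - {i}) \<union> f (Y' - {j})" by blast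
      moreover have un: "f (Y' - {i}) \<union> f (Y' - {j}) \<subseteq> f Y'" using sub by blast
      ultimately have "card (f Y') \<le> card (f (Y' - {i}) \<union> f (Y' - {j}))"
        using psubset_card_mono[OF finite_subset[OF un finf[OF Y'n]]] ci[OF ij(1)] cY' by fastforce
      then have "f (Y' - {i}) \<union> f (Y' - {j}) = f Y'"
        using card_seteq[OF finf[OF Y'n] un] by blast
      then have "g i = f Y'" using full[OF gb(1)[OF ij(1)]] sub2 by simp
      then show False using blue(1)[of Y'] Y'n gb(1)[OF ij(1)] by (simp add: Pow)
    qed
    then have "card Y' \<le> card ({1..?N} - f Y')"
      using gb(2) by (intro card_inj_on_le) auto
    also have "\<dots> = n - t - 1" using cY' fN[OF Y'n] by (simp add: card_Diff_subset finf[OF Y'n])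
    finally show False using Y'(2) assms(6,7) by simp
  qed
  define A where "A = f {}"
  have cA: "Suc (card A) = m" using lower_eq[of "{}"] assms(5) by (simp add: A_def)
  have AN: "A \<subseteq> {1..?N}" using fN[of "{}"] by (simp add: A_def)
  have finA: "finite A" using AN finite_subset by blast
  \<comment> \<open>\<open>\<phi> i\<close> will be the point that the image of \<open>{i}\<close>
    adds to \<open>A\<close>, and \<open>\<psi> i\<close> the point missing from the image of the
    complement of \<open>{i}\<close>.\<close>
  have "\<exists>a. a \<notin> A \<and> f {i} = insert a A" if "i \<in> {1..n}" for i
  proof -
    have "A \<subseteq> f {i}" unfolding A_def using that by (intro fmono) auto
    moreover have "card (f {i}) = Suc (card A)" using lower_eq[of "{i}"] that assms(5) cA by simp
    ultimately show ?thesis using insert_of_card_Suc[OF finf[of "{i}"]] that by (metis empty_subsetI insert_subset)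
  qed
  then obtain \<phi> where \<phi>: "\<And>i. i \<in> {1..n} \<Longrightarrow> \<phi> i \<notin> A" "\<And>i. i \<in> {1..n} \<Longrightarrow> f {i} = insert (\<phi> i) A"
    by metis
  have top: "f {1..n} = {1..?N}"
    using card_subset_eq[OF _ fN[of "{1..n}"]] upper_eq[of "{1..n}"] assms(6) by simp
  have "\<exists>b. b \<in> {1..?N} \<and> f ({1..n} - {i}) = {1..?N} - {b}" if i: "i \<in> {1..n}" for i
  proof -
    have "Suc (card (f ({1..n} - {i}))) = ?N" using upper_eq[of "{1..n} - {i}"] i assms(6) by auto
    moreover have "f ({1..n} - {i}) \<subseteq> {1..?N}" by (rule fN) auto
    ultimately obtain b where "b \<notin> f ({1..n} - {i})" "{1..?N} = insert b (f ({1..n} - {i}))"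
      using insert_of_card_Suc[of "{1..?N}" "f ({1..n} - {i})"] by auto
    then show ?thesis by auto
  qed
  then obtain \<psi> where \<psi>: "\<And>i. i \<in> {1..n} \<Longrightarrow> \<psi> i \<in> {1..?N}"
    "\<And>i. i \<in> {1..n} \<Longrightarrow> f ({1..n} - {i}) = {1..?N} - {\<psi> i}" by metis
  have inj\<phi>: "inj_on \<phi> {1..n}"
  proof (rule inj_onI)
    fix i j assume "i \<in> {1..n}" "j \<in> {1..n}" "\<phi> i = \<phi> j"
    then show "i = j" using feq[of "{i}" "{j}"] \<phi>(2) by auto
  qed
  have inj\<psi>: "inj_on \<psi> {1..n}"
  proof (rule inj_onI)
    fix i j assume ij: "i \<in> {1..n}" "j \<in> {1..n}" "\<psi> i = \<psi> j"
    then have "f ({1..n} - {i}) = f ({1..n} - {j})" using \<psi>(2) by simp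
    then have "{1..n} - {i} = {1..n} - {j}" by (rule feq) auto
    then show "i = j" using ij by blast
  qed
  \<comment> \<open>Monotonicity forces \<open>A\<close> and the \<open>\<phi>\<close>-values into
    \<open>f Y\<close> and keeps the \<open>\<psi>\<close>-values of the complement out; in each
    case of \<open>dich\<close> the size turns one of these inclusions into an equality.\<close>
  have shape: "f Y = A \<union> \<phi> ` Y \<or> f Y = {1..?N} - \<psi> ` ({1..n} - Y)" if Y: "Y \<subseteq> {1..n}" for Y
    using dich[OF Y]
  proof
    assume c: "Suc (card (f Y)) = card Y + m"
    have "A \<union> \<phi> ` Y \<subseteq> f Y"
    proof -
      have "A \<subseteq> f Y" unfolding A_def by (rule fmono[OF _ Y]) simp
      moreover have "\<phi> i \<in> f Y" if "i \<in> Y" for i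
        using fmono[OF _ Y, of "{i}"] \<phi>(2)[of i] that Y by auto
      ultimately show ?thesis by blast
    qed
    moreover have "card (A \<union> \<phi> ` Y) = card (f Y)"
    proof -
      have "card (A \<union> \<phi> ` Y) = card A + card (\<phi> ` Y)"
        using \<phi>(1) Y finA fin[OF Y] by (intro card_Un_disjoint) auto
      also have "card (\<phi> ` Y) = card Y" using inj_on_subset[OF inj\<phi> Y] by (rule card_image)
      finally show ?thesis using c cA by simp
    qed
    ultimately show ?thesis using card_subset_eq[OF finf[OF Y]] by metis
  next
    assume c: "card (f Y) = card Y + m"
    have "f Y \<subseteq> {1..?N} - \<psi> ` ({1..n} - Y)"
    proof -
      have "\<psi> i \<notin> f Y" if i: "i \<in> {1..n} - Y" for i
        using fmono[of Y "{1..n} - {i}"] \<psi>(2)[of i] i Y by auto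
      then show ?thesis using fN[OF Y] by blast
    qed
    moreover have "card ({1..?N} - \<psi> ` ({1..n} - Y)) = card (f Y)"
    proof -
      have "card ({1..?N} - \<psi> ` ({1..n} - Y)) = ?N - card (\<psi> ` ({1..n} - Y))"
        using \<psi>(1) by (subst card_Diff_subset) auto
      also have "card (\<psi> ` ({1..n} - Y)) = n - card Y"
        using card_image[OF inj_on_subset[OF inj\<psi>], of "{1..n} - Y"] Y
        by (simp add: card_Diff_subset fin)
      finally show ?thesis using c card_mono[OF _ Y] by simp
    qed
    ultimately show ?thesis using card_subset_eq[of "{1..?N} - \<psi> ` ({1..n} - Y)" "f Y"] by simp
  qed
  have A\<psi>: "\<psi> y \<notin> A" if y: "y \<in> {1..n}" for y
    using fmono[of "{}" "{1..n} - {y}"] \<psi>(2)[OF y] by (auto simp: A_def)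
  have \<phi>\<psi>: "\<phi> x \<noteq> \<psi> y" if "x \<in> {1..n}" "y \<in> {1..n}" "x \<noteq> y" for x y
    using fmono[of "{x}" "{1..n} - {y}"] \<psi>(2)[OF that(2)] \<phi>(2)[OF that(1)] that by auto
  have \<phi>N: "\<phi> x \<in> {1..?N}" if "x \<in> {1..n}" for x using fN[of "{x}"] \<phi>(2)[OF that] that by auto
  \<comment> \<open>Outside \<open>A\<close> there are \<open>n + 1\<close> points, of which
    \<open>\<psi>\<close> takes \<open>n\<close>; the last one is \<open>w\<close>. As
    \<open>\<phi> x\<close> avoids \<open>\<psi> y\<close> for \<open>y \<noteq> x\<close>, only
    \<open>\<psi> x\<close> and \<open>w\<close> remain for it.\<close>
  have "card ({1..?N} - A - \<psi> ` {1..n}) = 1"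
  proof -
    have "card ({1..?N} - A - \<psi> ` {1..n}) = card ({1..?N} - A) - card (\<psi> ` {1..n})"
      using \<psi>(1) A\<psi> by (intro card_Diff_subset) auto
    then show ?thesis using card_image[OF inj\<psi>] AN finA cA by (simp add: card_Diff_subset)
  qed
  then obtain w where w: "{1..?N} - A - \<psi> ` {1..n} = {w}" by (auto simp: card_1_singleton_iff)
  have \<phi>_cases: "\<phi> x = \<psi> x \<or> \<phi> x = w" if x: "x \<in> {1..n}" for x
  proof (rule ccontr)
    assume c: "\<not> ?thesis"
    then have "\<phi> x \<in> \<psi> ` {1..n}" using w \<phi>N[OF x] \<phi>(1)[OF x] by blast
    then obtain y where "y \<in> {1..n}" "\<phi> x = \<psi> y" by blast
    then show False using \<phi>\<psi>[OF x, of y] c by blast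
  qed
  \<comment> \<open>By injectivity \<open>\<phi>\<close> takes the value \<open>w\<close> at most
    once, and \<open>x0\<close> is that argument. If there is none, \<open>x0 = 1\<close> is an
    arbitrary choice.\<close>
  obtain x0 where x0: "x0 \<in> {1..n}" "\<And>x. x \<in> {1..n} \<Longrightarrow> x \<noteq> x0 \<Longrightarrow> \<phi> x = \<psi> x"
  proof (cases "\<exists>x\<in>{1..n}. \<phi> x = w")
    case True
    then obtain x where x: "x \<in> {1..n}" "\<phi> x = w" by blast
    show ?thesis
    proof (rule that[OF x(1)])
      show "\<phi> y = \<psi> y" if "y \<in> {1..n}" "y \<noteq> x" for y
        using \<phi>_cases[OF that(1)] inj_onD[OF inj\<phi> _ that(1) x(1)] x(2) that(2) by auto
    qed
  next
    case False
    show ?thesis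
    proof (rule that[of 1])
      show "\<phi> y = \<psi> y" if "y \<in> {1..n}" for y
        using \<phi>_cases[OF that] that False by blast
    qed (use assms(6) in simp)
  qed
  have "w \<in> {1..?N} - A - \<psi> ` {1..n}" using w by blast
  then have "w \<in> {1..?N} - A" "w \<noteq> \<psi> x0" using x0(1) by blast+
  then obtain g where g: "g \<in> G" "p g = w" "w \<in> g" "A \<subseteq> g" "\<psi> x0 \<notin> g"
    using cover[OF AN cA, of w "\<psi> x0"] \<psi>(1)[OF x0(1)] A\<psi>[OF x0(1)] by blast
  \<comment> \<open>Since \<open>\<psi> x0 \<notin> g\<close>, the point \<open>x0\<close> is not in
    \<open>Y\<close>, so \<open>\<phi>\<close> and \<open>\<psi>\<close> agree on \<open>Y\<close>.
    This makes the lower option of \<open>shape\<close> equal to \<open>g - {w}\<close>, while the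
    upper option is \<open>g\<close>.\<close>
  define Y where "Y = {y \<in> {1..n}. \<psi> y \<in> g}"
  have Yn: "Y \<subseteq> {1..n}" by (auto simp: Y_def)
  have N_cases: "x \<in> A \<or> x = w \<or> x \<in> \<psi> ` {1..n}" if "x \<in> {1..?N}" for x using w that by blast
  have w\<psi>: "w \<notin> A" "w \<notin> \<psi> ` {1..n}" using w by blast+
  have gN: "g \<subseteq> {1..?N}" using G(1)[OF g(1)] .
  have g_eq: "g = insert w (A \<union> \<psi> ` Y)"
  proof (intro subset_antisym subsetI)
    fix x assume x: "x \<in> g"
    then have "x \<in> A \<or> x = w \<or> x \<in> \<psi> ` {1..n}" using N_cases gN by blast
    then show "x \<in> insert w (A \<union> \<psi> ` Y)" using x unfolding Y_def by blast
  next
    fix x assume "x \<in> insert w (A \<union> \<psi> ` Y)"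
    then show "x \<in> g" using g(3,4) unfolding Y_def by blast
  qed
  have upper: "{1..?N} - \<psi> ` ({1..n} - Y) = g"
  proof (intro subset_antisym subsetI)
    fix x assume "x \<in> {1..?N} - \<psi> ` ({1..n} - Y)"
    then show "x \<in> g" unfolding g_eq using N_cases[of x] by blast
  next
    fix x assume "x \<in> g"
    then show "x \<in> {1..?N} - \<psi> ` ({1..n} - Y)" using gN unfolding Y_def by blast
  qed
  have "\<phi> ` Y = \<psi> ` Y"
  proof (rule image_cong)
    show "\<phi> x = \<psi> x" if x: "x \<in> Y" for x
    proof (rule x0(2))
      show "x \<in> {1..n}" "x \<noteq> x0" using x g(5) by (auto simp: Y_def)
    qed
  qed simp
  moreover have "g - {p g} = A \<union> \<psi> ` Y" unfolding g(2) using w\<psi> Yn by (subst g_eq) blast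
  ultimately have "A \<union> \<phi> ` Y = g - {p g}" by simp
  then show False using shape[OF Yn] upper blue(1)[of Y] blue(2)[of Y g] g(1) Yn by (simp add: Pow)
qed

section \<open>The marked packing and the colouring\<close>

text \<open>A closed ball of radius 1 in the Johnson graph: apart from \<open>g\<close>, every
  member exchanges one of the \<open>a\<close> points of \<open>g\<close> for one of the
  \<open>b\<close> points outside.\<close>

lemma card_Johnson_ball:
  assumes "finite U" "card U = a + b" "g \<subseteq> U" "card g = a"
  shows "card {g' \<in> {g'. g' \<subseteq> U \<and> card g' = a}. a \<le> Suc (card (g \<inter> g'))} \<le> 1 + a * b"
proof -
  have fing: "finite g" using assms(1,3) finite_subset by blast
  have "{g' \<in> {g'. g' \<subseteq> U \<and> card g' = a}. a \<le> Suc (card (g \<inter> g'))}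
      \<subseteq> insert g ((\<lambda>(x, y). insert y (g - {x})) ` (g \<times> (U - g)))"
  proof
    fix g' assume "g' \<in> {g' \<in> {g'. g' \<subseteq> U \<and> card g' = a}. a \<le> Suc (card (g \<inter> g'))}"
    then have g': "g' \<subseteq> U" "card g' = a" "a \<le> Suc (card (g \<inter> g'))" by auto
    have fing': "finite g'" using assms(1) g'(1) finite_subset by blast
    show "g' \<in> insert g ((\<lambda>(x, y). insert y (g - {x})) ` (g \<times> (U - g)))"
    proof (cases "g' = g")
      case False
      then have "g \<inter> g' \<subset> g" using card_subset_eq[OF fing', of g] g'(2) assms(4) by blast
      then have lt: "card (g \<inter> g') < a" using psubset_card_mono[OF fing] assms(4) by metis
      then have "card (g - g') = 1" "card (g' - g) = 1"
        using g' assms(4) fing fing' by (auto simp: card_Diff_subset_Int Int_commute)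
      then obtain x y where xy: "g - g' = {x}" "g' - g = {y}" by (auto simp: card_1_singleton_iff)
      then have "g' = insert y (g - {x})" "x \<in> g" "y \<in> U - g" using g'(1) by blast+
      then show ?thesis by force
    qed simp
  qed
  then have "card {g' \<in> {g'. g' \<subseteq> U \<and> card g' = a}. a \<le> Suc (card (g \<inter> g'))}
      \<le> card (insert g ((\<lambda>(x, y). insert y (g - {x})) ` (g \<times> (U - g))))"
    using fing assms(1) by (intro card_mono) auto
  also have "\<dots> \<le> Suc (card ((\<lambda>(x, y). insert y (g - {x})) ` (g \<times> (U - g))))"
    by (rule card_insert_le_m1) simp_all
  also have "\<dots> \<le> Suc (card (g \<times> (U - g)))"
    using fing assms(1) by (intro Suc_le_mono[THEN iffD2] card_image_le) auto
  also have "card (g \<times> (U - g)) = a * b"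
    using assms by (simp add: card_cartesian_product card_Diff_subset[OF fing])
  finally show ?thesis by simp
qed

lemma exists_marked_packing:
  fixes m n t :: nat
  defines "t \<equiv> (n - 1) div 2"
  assumes "1 \<le> m" "m \<le> n" "n \<ge> 68"
  shows "\<exists>G p. (\<forall>g\<in>G. g \<subseteq> {1..m + n} \<and> card g = m + t + 1) \<and>
    (\<forall>g\<in>G. \<forall>g'\<in>G. m + t \<le> card (g \<inter> g') \<longrightarrow> g = g') \<and>
    (\<forall>A w w'. A \<subseteq> {1..m + n} \<and> Suc (card A) = m \<and> w \<in> {1..m + n} - A \<and> w' \<in> {1..m + n} - A \<and> w \<noteq> w' \<longrightarrow>
      (\<exists>g\<in>G. p g = w \<and> w \<in> g \<and> A \<subseteq> g \<and> w' \<notin> g))"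
proof -
  define U where "U = {1..m + n}"
  define K where "K = {g. g \<subseteq> U \<and> card g = m + t + 1}"
  define R where "R g g' \<longleftrightarrow> g = g' \<or> m + t \<le> card (g \<inter> g')" for g g' :: "nat set"
  define V where "V = {1..8 * n ^ 3}"
  define cand where "cand A w w' = {g \<in> K. w \<in> g \<and> A \<subseteq> g \<and> w' \<notin> g}" for A w w'
  define D where "D = {(A, w, w'). A \<subseteq> U \<and> Suc (card A) = m \<and> w \<in> U - A \<and> w' \<in> U - A \<and> w \<noteq> w'}"
  define tests where "tests = (\<lambda>(A, w, w'). (w, cand A w w')) ` D"
  have cU: "finite U" "card U = m + n" by (simp_all add: U_def)
  have finK: "finite K" unfolding K_def by (rule finite_subset[of _ "Pow U"]) (use cU in auto)
  have t: "t + 1 \<le> n" using assms(4) by (simp add: t_def)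
  have sub: "D \<subseteq> Pow U \<times> U \<times> U" by (auto simp: D_def)
  have finD: "finite D" by (rule finite_subset[OF sub]) (use cU in auto)
  have "card D \<le> card (Pow U \<times> U \<times> U)" using sub by (intro card_mono) (use cU in auto)
  also have "\<dots> = 2 ^ (m + n) * (m + n)\<^sup>2"
    using cU by (simp add: card_cartesian_product card_Pow power2_eq_square)
  finally have "card tests \<le> 2 ^ (m + n) * (m + n)\<^sup>2"
    unfolding tests_def using card_image_le[OF finD] order_trans by blast
  note union = union_bound_lt_one[OF assms(3,4) this]
  \<comment> \<open>Marked points have to occur among the labels, so \<open>V\<close> must contain
    \<open>U\<close>.\<close>
  have n3: "m + n \<le> 8 * n ^ 3"
  proof -
    have "m + n \<le> 2 * n * 1" using assms(3) by simp
    also have "\<dots> \<le> 2 * n * (4 * n ^ 2)" using assms(4) by (intro mult_le_mono2) (simp add: Suc_le_eq)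
    also have "\<dots> = 8 * n ^ 3" by (simp add: power3_eq_cube power2_eq_square)
    finally show ?thesis .
  qed
  have UV: "U \<subseteq> V" using n3 by (auto simp: U_def V_def)
  \<comment> \<open>Adding \<open>w\<close> and any \<open>t + 1\<close> of the \<open>n - 1\<close>
    points outside \<open>A\<close> other than \<open>w\<close> and \<open>w'\<close> to
    \<open>A\<close> gives a candidate, of size \<open>(m - 1) + 1 + (t + 1)\<close>.\<close>
  have cand_card: "192 * n ^ 8 \<le> card (cand A w w')" if D: "(A, w, w') \<in> D" for A w w'
  proof -
    define E where "E = U - A - {w, w'}"
    have D': "A \<subseteq> U" "Suc (card A) = m" "w \<in> U - A" "w' \<in> U - A" "w \<noteq> w'"
      using D by (auto simp: D_def)
    have fin: "finite A" "finite E" using D' cU finite_subset by (auto simp: E_def)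
    have "card (U - A) = n + 1" using D'(1,2) cU fin by (simp add: card_Diff_subset)
    moreover have "card E = card (U - A) - 2"
      unfolding E_def using D' by (subst card_Diff_subset) auto
    ultimately have cE: "card E = n - 1" by simp
    have inj: "inj_on (\<lambda>S. insert w (A \<union> S)) {S. S \<subseteq> E \<and> card S = Suc t}"
    proof (rule inj_onI)
      fix S S' assume S: "S \<in> {S. S \<subseteq> E \<and> card S = Suc t}" "S' \<in> {S. S \<subseteq> E \<and> card S = Suc t}"
        and eq: "insert w (A \<union> S) = insert w (A \<union> S')"
      have "S = insert w (A \<union> S) \<inter> E" "S' = insert w (A \<union> S') \<inter> E"
        using S by (auto simp: E_def)
      then show "S = S'" using eq by metis
    qed
    have "(\<lambda>S. insert w (A \<union> S)) ` {S. S \<subseteq> E \<and> card S = Suc t} \<subseteq> cand A w w'"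
    proof (rule image_subsetI)
      fix S assume "S \<in> {S. S \<subseteq> E \<and> card S = Suc t}"
      then have S: "S \<subseteq> E" "card S = Suc t" by auto
      have "finite S" using finite_subset[OF S(1) fin(2)] .
      moreover have "w \<notin> A \<union> S" "A \<inter> S = {}" using S(1) D' by (auto simp: E_def)
      ultimately have "card (insert w (A \<union> S)) = m + t + 1"
        using fin(1) S(2) D'(2) by (simp add: card_Un_disjoint)
      moreover have "insert w (A \<union> S) \<subseteq> U" "w' \<notin> insert w (A \<union> S)" using S(1) D' by (auto simp: E_def)
      ultimately show "insert w (A \<union> S) \<in> cand A w w'" unfolding cand_def K_def by auto
    qed
    then have "card {S. S \<subseteq> E \<and> card S = Suc t} \<le> card (cand A w w')"
      using finK by (intro card_inj_on_le[OF inj]) (auto simp: cand_def)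
    then show ?thesis
      using n_subsets[OF fin(2), of "Suc t"] cE pow8_le_choose_half[OF assms(4)] unfolding t_def by simp
  qed
  \<comment> \<open>Every set is its own label set, so an active \<open>g\<close> is marked at one
    of its elements. The size \<open>8 * n ^ 3\<close> of \<open>V\<close> is exactly
    \<open>2 * \<delta> * q\<close>.\<close>
  obtain G p where G: "G \<subseteq> K" "\<And>g g'. g \<in> G \<Longrightarrow> g' \<in> G \<Longrightarrow> R g g' \<Longrightarrow> g = g'"
    "\<And>w C. (w, C) \<in> tests \<Longrightarrow> \<exists>g\<in>C. g \<in> G \<and> p g = w"
  proof (rule exists_labelled_independent_set[where K = K and V = V and R = R and lab = "\<lambda>g. g"
        and \<delta> = "2 * n\<^sup>2" and q = "2 * n" and L = "48 * n ^ 4" and tests = tests])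
    show "card {g' \<in> K. R g g'} \<le> 2 * n\<^sup>2" if "g \<in> K" for g
    proof -
      have g: "g \<subseteq> U" "card g = m + t + 1" using that by (auto simp: K_def)
      have "{g' \<in> K. R g g'} = {g' \<in> {g'. g' \<subseteq> U \<and> card g' = m + t + 1}. m + t + 1 \<le> Suc (card (g \<inter> g'))}"
        using g by (auto simp: K_def R_def)
      then have "card {g' \<in> K. R g g'} \<le> 1 + (m + t + 1) * (n - t - 1)"
        using card_Johnson_ball[OF cU(1) _ g, of "n - t - 1"] cU(2) t by simp
      also have "\<dots> \<le> 1 + (2 * n) * (n - 1)"
        using assms(3) t by (intro add_left_mono mult_le_mono) auto
      also have "\<dots> \<le> 2 * n\<^sup>2"
        using assms(4) by (cases n) (auto simp: power2_eq_square algebra_simps)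
      finally show ?thesis .
    qed
    show "card g \<le> 2 * n" if "g \<in> K" for g using that assms(3) t by (simp add: K_def)
    show "2 * (2 * n\<^sup>2) * (2 * n) \<le> card V" by (simp add: V_def power3_eq_cube power2_eq_square)
    show "real (card tests) * (1 - 1 / (2 * real (card V))) ^ (48 * n ^ 4) < 1"
      using union by (simp add: V_def)
    show "V \<noteq> {}" "0 < 2 * n\<^sup>2" using assms(4) by (simp_all add: V_def Suc_le_eq)
    show "w \<in> V \<and> C \<subseteq> K \<and> (2 * n\<^sup>2)\<^sup>2 * (48 * n ^ 4) \<le> card C \<and> (\<forall>g\<in>C. w \<in> g)"
      if wC: "(w, C) \<in> tests" for w C
    proof -
      obtain A w' where Aw: "(A, w, w') \<in> D" "C = cand A w w'" using wC by (auto simp: tests_def)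
      have "(2 * n\<^sup>2)\<^sup>2 * (48 * n ^ 4) = 192 * n ^ 8"
        by (simp add: power_mult_distrib flip: power_mult power_add)
      then show ?thesis using cand_card[OF Aw(1)] Aw UV by (auto simp: cand_def D_def)
    qed
  qed (use finK finD UV in \<open>auto simp: V_def R_def K_def tests_def Int_commute\<close>)
  show ?thesis
  proof (intro exI[of _ G] exI[of _ p] conjI ballI allI impI)
    fix A w w'
    assume "A \<subseteq> {1..m + n} \<and> Suc (card A) = m \<and> w \<in> {1..m + n} - A \<and> w' \<in> {1..m + n} - A \<and> w \<noteq> w'"
    then have "(A, w, w') \<in> D" by (simp add: D_def U_def)
    then have "(w, cand A w w') \<in> tests" unfolding tests_def by (rule image_eqI[rotated]) simp
    then obtain g where "g \<in> cand A w w'" "g \<in> G" "p g = w" using G(3) by blast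
    then show "\<exists>g\<in>G. p g = w \<and> w \<in> g \<and> A \<subseteq> g \<and> w' \<notin> g" unfolding cand_def by blast
  qed (use G(1,2) in \<open>auto simp: K_def R_def U_def\<close>)
qed

section \<open>The colouring in dimension m + n\<close>

lemma not_weak_ramsey_of_le:
  fixes m n :: nat
  assumes "2 \<le> m" "m \<le> n" "n \<ge> 68"
  shows "\<not> weak_ramsey (boolean_lattice m) (boolean_lattice n) (m + n)"
proof -
  define t where "t = (n - 1) div 2"
  have "1 \<le> m" using assms(1) by simp
  from exists_marked_packing[OF this assms(2,3), folded t_def]
  obtain G p where G': "\<forall>g\<in>G. g \<subseteq> {1..m + n} \<and> card g = m + t + 1"
      "\<forall>g\<in>G. \<forall>g'\<in>G. m + t \<le> card (g \<inter> g') \<longrightarrow> g = g'"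
      "\<forall>A w w'. A \<subseteq> {1..m + n} \<and> Suc (card A) = m \<and> w \<in> {1..m + n} - A \<and> w' \<in> {1..m + n} - A \<and> w \<noteq> w' \<longrightarrow>
        (\<exists>g\<in>G. p g = w \<and> w \<in> g \<and> A \<subseteq> g \<and> w' \<notin> g)"
    by (elim exE conjE) (rule that)
  note G = G'(1)[rule_format, THEN conjunct1] G'(1)[rule_format, THEN conjunct2] G'(2)[rule_format]
  \<comment> \<open>The red sets of level \<open>m + t\<close>. If \<open>p g \<notin> g\<close> for
    some \<open>g\<close> in \<open>G\<close>, then \<open>g - {p g}\<close> is \<open>g\<close>,
    and all \<open>(m + t)\<close>-subsets of \<open>g\<close> belong to \<open>F\<close>.\<close>
  define F where "F = {H. card H = m + t \<and> (\<exists>g\<in>G. H \<subseteq> g \<and> H \<noteq> g - {p g})}"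
  define B where "B = {X. Suc (card X) < m} \<union> {H. card H = m + t \<and> H \<notin> F} \<union> G"
  define c where "c X = (if X \<in> B then Blue else Red)" for X
  have c: "c X = Blue \<longleftrightarrow> X \<in> B" "c X = Red \<longleftrightarrow> X \<notin> B" for X by (auto simp: c_def)
  have no_blue: False if copy: "weak_copy (boolean_lattice m) (boolean_lattice (m + n)) S"
    and S: "\<forall>x\<in>S. c x = Blue" for S
  proof -
    obtain f where f: "inj_on f (boolean_lattice m)" "mono_on (boolean_lattice m) f"
      "f ` boolean_lattice m = S" "f ` boolean_lattice m \<subseteq> boolean_lattice (m + n)"
      using copy unfolding weak_copy_def by blast
    have inB: "f X \<in> B" if "X \<in> boolean_lattice m" for X using f(3) S that c by blast
    note growth = inj_mono_card_growth[OF f(1,2,4)]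
    let ?T = "{1..m}"
    have T: "?T \<in> boolean_lattice m" "?T - {i} \<in> boolean_lattice m" for i by (auto simp: boolean_lattice_def)
    \<comment> \<open>The image of a coatom is too large for the low blue levels, so its size is at
      least \<open>m + t\<close>; the top image is larger and thus in \<open>G\<close>. Below it
      only the set without the marked point is blue on level \<open>m + t\<close>, so all coatoms
      share one image, and \<open>m \<ge> 2\<close> supplies two of them.\<close>
    have "f (?T - {i}) = f ?T - {p (f ?T)}" if i: "i \<in> ?T" for i
    proof -
      have cT: "card (?T - {i}) = m - 1" using i by simp
      have "m - 1 \<le> card (f (?T - {i}))" using growth[of "{}" "?T - {i}"] T cT by simp
      then have "f (?T - {i}) \<in> G \<or> card (f (?T - {i})) = m + t \<and> f (?T - {i}) \<notin> F"
        using inB[OF T(2)[of i]] by (auto simp: B_def)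
      then have ge: "m + t \<le> card (f (?T - {i}))" using G(2)[of "f (?T - {i})"] by linarith
      have less: "card (f (?T - {i})) + 1 \<le> card (f ?T)"
      proof -
        have "?T - (?T - {i}) = {i}" using i by auto
        then show ?thesis using growth[of "?T - {i}" ?T] T by simp
      qed
      then have top: "f ?T \<in> G" using inB[OF T(1)] ge by (auto simp: B_def)
      then have cH: "card (f (?T - {i})) = m + t" using G(2)[OF top] ge less by linarith
      then have "f (?T - {i}) \<notin> G" using G(2)[of "f (?T - {i})"] by linarith
      then have "f (?T - {i}) \<notin> F" using inB[OF T(2)[of i]] cH by (auto simp: B_def)
      moreover have "f (?T - {i}) \<subseteq> f ?T" using monotone_onD[OF f(2) T(2,1)] by auto
      ultimately show ?thesis using top cH unfolding F_def by blast
    qed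
    from this[of 1] this[of 2] have "f (?T - {1}) = f (?T - {2})" using assms(1) by simp
    then have "?T - {1} = ?T - {2}" using inj_onD[OF f(1)] T(2) by blast
    moreover have "2 \<in> ?T - {1}" using assms(1) by simp
    ultimately show False by blast
  qed
  have no_red: False if copy: "weak_copy (boolean_lattice n) (boolean_lattice (m + n)) S"
    and S: "\<forall>x\<in>S. c x = Red" for S
  proof -
    obtain f where f: "inj_on f (boolean_lattice n)" "mono_on (boolean_lattice n) f"
      "f ` boolean_lattice n = S" "f ` boolean_lattice n \<subseteq> boolean_lattice (m + n)"
      using copy unfolding weak_copy_def by blast
    have notB: "f X \<notin> B" if "X \<in> boolean_lattice n" for X using f(3) S that c by blast
    show False
    proof (rule no_red_copy[OF f(1,2,4), where t = t and G = G and p = p])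
      show "2 \<le> t" "t + 3 \<le> n" "n < 2 * t + 3" using assms(3) by (auto simp: t_def)
      show "f X \<noteq> g - {p g}" if X: "X \<in> boolean_lattice n" and g: "g \<in> G" for X g
      proof
        assume eq: "f X = g - {p g}"
        have fin: "finite g" using G(1)[OF g] finite_subset by blast
        \<comment> \<open>If \<open>p g \<notin> g\<close>, then \<open>g - {p g}\<close> would be
          the blue set \<open>g\<close>; so \<open>f X\<close> has size \<open>m + t\<close>. Being
          red there, it also lies below some \<open>g'\<close> as a set other than
          \<open>g' - {p g'}\<close>, and packing gives \<open>g = g'\<close>.\<close>
        have ne: "f X \<noteq> g" using notB[OF X] g by (auto simp: B_def)
        then have cX: "card (f X) = m + t" using eq G(2)[OF g] fin by (cases "p g \<in> g") auto
        then have "f X \<in> F" using notB[OF X] by (auto simp: B_def)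
        then obtain g' where g': "g' \<in> G" "f X \<subseteq> g'" "f X \<noteq> g' - {p g'}" by (auto simp: F_def)
        have "card (f X) \<le> card (g \<inter> g')" using fin g'(2) eq by (intro card_mono) auto
        then have "g = g'" using G(3) g g'(1) cX by simp
        then show False using eq g'(3) by simp
      qed
      show "\<exists>g\<in>G. f X \<subseteq> g" if "X \<in> boolean_lattice n" "card (f X) = m + t" for X
        using notB[OF that(1)] that(2) by (auto simp: B_def F_def)
      show "m \<le> Suc (card (f X))" "f X \<notin> G" if "X \<in> boolean_lattice n" for X
        using notB[OF that] by (auto simp: B_def)
      show "\<exists>g\<in>G. p g = w \<and> w \<in> g \<and> A \<subseteq> g \<and> w' \<notin> g"
        if "A \<subseteq> {1..m + n}" "Suc (card A) = m" "w \<in> {1..m + n} - A" "w' \<in> {1..m + n} - A" "w \<noteq> w'" for A w w'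
        using G'(3) that by blast
    qed (use G assms(1) in auto)
  qed
  show ?thesis unfolding weak_ramsey_def using no_blue no_red by blast
qed

section \<open>Symmetry in the colours and monotonicity in the dimension\<close>

lemma weak_ramsey_commute:
  assumes "weak_ramsey P1 P2 N"
  shows "weak_ramsey P2 P1 N"
  unfolding weak_ramsey_def
proof
  fix c :: "nat set \<Rightarrow> colour"
  define d where "d X = (if c X = Blue then Red else Blue)" for X
  have d: "d X = Blue \<longleftrightarrow> c X = Red" "d X = Red \<longleftrightarrow> c X = Blue" for X
    by (cases "c X"; simp add: d_def)+
  show "(\<exists>S. weak_copy P2 (boolean_lattice N) S \<and> (\<forall>x\<in>S. c x = Blue)) \<or>
      (\<exists>S. weak_copy P1 (boolean_lattice N) S \<and> (\<forall>x\<in>S. c x = Red))"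
    using assms[unfolded weak_ramsey_def, rule_format, of d] unfolding d by blast
qed

lemma weak_copy_mono:
  assumes "weak_copy P Q S" "Q \<subseteq> Q'"
  shows "weak_copy P Q' S"
  using assms subset_trans[of S Q Q'] by (simp add: weak_copy_def)

lemma weak_ramsey_mono:
  assumes "weak_ramsey P1 P2 M" "M \<le> N"
  shows "weak_ramsey P1 P2 N"
  unfolding weak_ramsey_def
proof
  fix c :: "nat set \<Rightarrow> colour"
  have "boolean_lattice M \<subseteq> boolean_lattice N" using assms(2) by (auto simp: boolean_lattice_def)
  note lift = weak_copy_mono[OF _ this]
  show "(\<exists>S. weak_copy P1 (boolean_lattice N) S \<and> (\<forall>x\<in>S. c x = Blue)) \<or>
      (\<exists>S. weak_copy P2 (boolean_lattice N) S \<and> (\<forall>x\<in>S. c x = Red))"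
    using assms(1)[unfolded weak_ramsey_def, rule_format, of c] lift[of P1] lift[of P2] by blast
qed

lemma not_weak_ramsey_boolean_lattice:
  fixes m n :: nat
  assumes "2 \<le> m" "n \<ge> 68"
  shows "\<not> weak_ramsey (boolean_lattice m) (boolean_lattice n) (m + n)"
proof (cases "m \<le> n")
  case True
  then show ?thesis using not_weak_ramsey_of_le assms by blast
next
  case False
  then have "\<not> weak_ramsey (boolean_lattice n) (boolean_lattice m) (n + m)"
    using assms by (intro not_weak_ramsey_of_le) auto
  then show ?thesis using weak_ramsey_commute by (metis add.commute)
qed

theorem theorem2:
  fixes m n :: nat
  assumes "m \<ge> 2" and "n \<ge> 68"
  shows "weak_ramsey_number (boolean_lattice m) (boolean_lattice n) \<ge> m + n + 1"
proof (rule ccontr)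
  let ?r = "weak_ramsey_number (boolean_lattice m) (boolean_lattice n)"
  assume "\<not> m + n + 1 \<le> ?r"
  \<comment> \<open>The least \<open>N\<close> has the property itself because some \<open>N\<close>
    has it; otherwise \<open>LEAST\<close> would reveal nothing about \<open>?r\<close>.\<close>
  have "0 < ?r \<and> weak_ramsey (boolean_lattice m) (boolean_lattice n) ?r"
    unfolding weak_ramsey_number_def
    by (rule LeastI_ex[OF weak_ramsey_exists[OF finite_boolean_lattice finite_boolean_lattice]])
  then have "weak_ramsey (boolean_lattice m) (boolean_lattice n) (m + n)"
    using \<open>\<not> m + n + 1 \<le> ?r\<close> weak_ramsey_mono[of "boolean_lattice m" "boolean_lattice n" ?r "m + n"] by simp
  then show False using not_weak_ramsey_boolean_lattice[OF assms] by contradiction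
qed

end
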